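(* Let $k\geq1$ be an integer and let $\mu$ be the surface measure on the graph of the $(k,1)$-additive Brownian sheet in $\mathbb{R}^{k+1}$. Then, almost surely, for $p\in[1,\infty]$ and $q\in[1,\infty)$ with $2k(q-1)>1$, the extension estimate $$\|\widehat{f\mu}\|_{L^q(\mathbb{R}^{k+1})}\lesssim\|f\|_{L^p(\mu)}\quad\text{for all } f\in L^p(\mu)$$ cannot hold whenever $$p<\frac{2kq}{2k(q-1)-1}.$$ Equivalently, the restriction estimate $$\|\widehat f\,\|_{L^{p'}(\mu)}\lesssim\|f\|_{L^{q'}(\mathbb{R}^{k+1})}\quad\text{for all } f\in L^{q'}(\mathbb{R}^{k+1})$$ cannot hold whenever $$p'>\frac{2kq}{2k+1}.$$
   Context: The $(k,1)$-additive Brownian sheet is the random map $W:[0,1]^k\to\mathbb{R}$ given by $W(t)=\sum_{i=1}^k W^i(t_i)$ for $t=(t_1,\dots,t_k)\in[0,1]^k$, where $W^1,\dots,W^k:[0,1]\to\mathbb{R}$ are independent standard one-parameter Brownian motions (almost surely continuous, $W^i(0)=0$). Its graph is $G(W)=\{(t,W(t)):t\in[0,1]^k\}\subset\mathbb{R}^{k+1}$, and the surface measure $\mu$ on it is the Borel measure on $\mathbb{R}^{k+1}$ given by $\mu(E)=\mathcal{L}^k\{t\in[0,1]^k:(t,W(t))\in E\}$ for Borel $E\subset\mathbb{R}^{k+1}$, where $\mathcal{L}^k$ is $k$-dimensional Lebesgue measure. Here $\widehat{f\mu}(\xi)=\int e^{-2\pi i\xi\cdot x}f(x)\,d\mu(x)$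 and $\widehat f$ is the Fourier transform on $\mathbb{R}^{k+1}$. The notation $A\lesssim B$ means there is a finite constant $c$, independent of $f$ (but possibly depending on the realisation of $W$), with $A\leq cB$. The exponents $p',q'$ are the Hölder conjugates of $p,q$: $\frac1p+\frac1{p'}=\frac1q+\frac1{q'}=1$. The restriction estimate is understood in the usual a priori sense, as an inequality with a uniform constant for Schwartz functions $f$. *)

theory Defs
  imports "HOL-Probability.Probability"
begin

section \<open>Additive Brownian sheets and the surface measure on their graphs\<close>

definition (in prob_space) standard_brownian_motion :: "(real \<Rightarrow> 'a \<Rightarrow> real) \<Rightarrow> bool" where
  "standard_brownian_motion X \<longleftrightarrow>
     (\<forall>t\<in>{0..1}. random_variable borel (X t)) \<and>
     (AE \<omega> in M. X 0 \<omega> = 0) \<and>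
     (\<forall>s\<in>{0..1}. \<forall>t\<in>{0..1}. s < t \<longrightarrow>
        distributed M lborel (\<lambda>\<omega>. X t \<omega> - X s \<omega>) (normal_density 0 (sqrt (t - s)))) \<and>
     (\<forall>(n::nat) \<tau>. \<tau> ` {..n} \<subseteq> {0..1} \<and> mono_on {..n} \<tau> \<longrightarrow>
        indep_vars (\<lambda>_. borel) (\<lambda>i \<omega>. X (\<tau> (Suc i)) \<omega> - X (\<tau> i) \<omega>) {..<n}) \<and>
     (AE \<omega> in M. continuous_on {0..1} (\<lambda>t. X t \<omega>))"

text \<open>Independence of the processes is independence of the sigma-algebras they generate, that is,
  of the processes as random elements of the product space of paths \<open>{0..1} \<rightarrow> \<real>\<close>.\<close>

definition (in prob_space) indep_standard_brownian_motions ::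
    "('i \<Rightarrow> real \<Rightarrow> 'a \<Rightarrow> real) \<Rightarrow> bool" where
  "indep_standard_brownian_motions B \<longleftrightarrow>
     (\<forall>i. standard_brownian_motion (B i)) \<and>
     indep_vars (\<lambda>_. PiM {0..1} (\<lambda>_. borel)) (\<lambda>i \<omega>. \<lambda>t\<in>{0..1}. B i t \<omega>) UNIV"

definition additive_sheet :: "('k \<Rightarrow> real \<Rightarrow> 'w \<Rightarrow> real) \<Rightarrow> 'w \<Rightarrow> real ^ 'k \<Rightarrow> real" where
  "additive_sheet B \<omega> t = (\<Sum>i\<in>UNIV. B i (t $ i) \<omega>)"

text \<open>The space \<open>\<real>\<^sup>k\<^sup>+\<^sup>1\<close> is the Euclidean space \<open>(real ^ 'k) \<times> real\<close>, and \<open>cbox 0 1\<close> is the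
  unit cube. For continuous \<open>w\<close> the map below is Borel, so the value at a Borel set \<open>E\<close> is
  the Lebesgue measure of the set of all \<open>t\<close> in the cube with \<open>(t, w t) \<in> E\<close>.\<close>

definition surface_measure :: "(real ^ 'k \<Rightarrow> real) \<Rightarrow> ((real ^ 'k) \<times> real) measure" where
  "surface_measure w = distr (restrict_space lborel (cbox 0 1)) borel (\<lambda>t. (t, w t))"

section \<open>Lebesgue norms, Fourier transform, Schwartz functions\<close>

definition Lp_norm :: "'a measure \<Rightarrow> ennreal \<Rightarrow> ('a \<Rightarrow> complex) \<Rightarrow> ennreal" where
  "Lp_norm N p f =
     (if p = \<infinity> then esssup N (\<lambda>x. ennreal (norm (f x)))
      else let I = \<integral>\<^sup>+ x. ennreal (norm (f x) powr enn2real p) \<partial>N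
           in if I = \<infinity> then \<infinity> else ennreal (enn2real I powr (1 / enn2real p)))"

definition Lp_space :: "'a measure \<Rightarrow> ennreal \<Rightarrow> ('a \<Rightarrow> complex) set" where
  "Lp_space N p = {f \<in> borel_measurable N. Lp_norm N p f < \<infinity>}"

text \<open>The function \<open>fourier N f\<close> is the Fourier transform of the complex measure with density
  \<open>f\<close> with respect to \<open>N\<close>; for \<open>N = lborel\<close> it is the Fourier transform of \<open>f\<close>.\<close>

definition fourier :: "'a::euclidean_space measure \<Rightarrow> ('a \<Rightarrow> complex) \<Rightarrow> 'a \<Rightarrow> complex" where
  "fourier N f \<xi> = (LINT x|N. exp (- 2 * of_real pi * \<i> * of_real (\<xi> \<bullet> x)) * f x)"

fun iterated_partial :: "'a::euclidean_space list \<Rightarrow> ('a \<Rightarrow> complex) \<Rightarrow> 'a \<Rightarrow> complex" where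
  "iterated_partial [] f = f"
| "iterated_partial (b # bs) f = (\<lambda>x. frechet_derivative (iterated_partial bs f) (at x) b)"

text \<open>Smoothness is expressed by the (Frechet) differentiability of all iterated partial
  derivatives of \<open>f\<close>; this also makes all of them continuous.\<close>

definition schwartz :: "('a::euclidean_space \<Rightarrow> complex) \<Rightarrow> bool" where
  "schwartz f \<longleftrightarrow>
     (\<forall>bs. set bs \<subseteq> Basis \<longrightarrow>
        iterated_partial bs f differentiable_on UNIV \<and>
        (\<forall>n::nat. bounded (range (\<lambda>x. norm x ^ n *\<^sub>R iterated_partial bs f x))))"

section \<open>Extension and restriction estimates\<close>

definition extension_estimate :: "'a::euclidean_space measure \<Rightarrow> ennreal \<Rightarrow> ennreal \<Rightarrow> bool" where
  "extension_estimate \<mu> p q \<longleftrightarrow>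
     (\<exists>c::real. \<forall>f \<in> Lp_space \<mu> p. Lp_norm lborel q (fourier \<mu> f) \<le> ennreal c * Lp_norm \<mu> p f)"

text \<open>The restriction estimate from \<open>L\<^sup>r\<close> to \<open>L\<^sup>s(\<mu>)\<close> is an a priori estimate on Schwartz functions,
  whose Fourier transform is defined pointwise and hence on the support of \<open>\<mu>\<close>.\<close>

definition restriction_estimate :: "'a::euclidean_space measure \<Rightarrow> ennreal \<Rightarrow> ennreal \<Rightarrow> bool" where
  "restriction_estimate \<mu> r s \<longleftrightarrow>
     (\<exists>c::real. \<forall>f. schwartz f \<longrightarrow> Lp_norm \<mu> s (fourier lborel f) \<le> ennreal c * Lp_norm lborel r f)"

text \<open>In \<open>ennreal\<close> we have \<open>1 / \<infinity> = 0\<close> and \<open>1 / 0 = \<infinity>\<close>, so 1 and \<open>\<infinity>\<close> are conjugate.\<close>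

definition hoelder_conjugate :: "ennreal \<Rightarrow> ennreal \<Rightarrow> bool" where
  "hoelder_conjugate p p' \<longleftrightarrow> 1 / p + 1 / p' = 1"

end

theory Submission
  imports Defs "HOL-Real_Asymp.Real_Asymp"
begin

text \<open>A Knapp-type example at the origin. With \<open>\<delta> = 2\<^sup>-\<^sup>n\<close> and \<open>h = (n + 1) \<delta>\<^sup>1\<^sup>/\<^sup>2\<close>,
  the second moment \<open>E W(t)\<^sup>2 \<le> k\<^sup>2 \<delta>\<close> on \<open>[0, \<delta>]\<^sup>k\<close> and Fatou's lemma show that almost surely, for
  infinitely many \<open>n\<close>, at least half of the graph over \<open>[0, \<delta>]\<^sup>k\<close> lies in the slab
  \<open>[0, \<delta>]\<^sup>k \<times> [-h, h]\<close>. The indicator of the slab (for extension) and a Gaussian adapted to the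
  dual box of volume about \<open>1 / (\<delta>\<^sup>k h)\<close> (for restriction) then turn either estimate into a bound
  on \<open>\<delta> powr (k / p') * (\<delta>\<^sup>k h) powr (- 1 / q)\<close>, which tends to infinity in the stated range.\<close>

section \<open>Lebesgue norms and Fourier transforms on boxes\<close>

text \<open>The concentration step concerns the path alone and the exponents enter only through
  deterministic estimates on slabs, so one exceptional null set serves all p and q. Brownian scaling
  suggests h = \<delta>^(1/2), but at that height the second moment bounds the expected fraction of
  the cube on which |W| exceeds h only by the constant k^2. The factor n + 1 improves this to k^2 /
  (n + 1)^2, which tends to 0, and it costs only a power of n + 1 in a quantity that otherwise grows
  exponentially in n. Up to this factor the power of \<delta> in the final bound is k / p' - (k +
  1/2) / q; requiring it to be negative and solving for p or for p' gives the two thresholds. The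
  restriction estimate is a priori on Schwartz functions, hence it is tested directly on a Gaussian;
  an indicator would not be admissible there.\<close>

lemma Lp_norm_ge:
  assumes E: "E \<in> sets N" "emeasure N E = ennreal m" "0 < m"
    and v: "0 \<le> v" "\<And>x. x \<in> E \<Longrightarrow> v \<le> norm (F x)" and p: "0 < p"
  shows "ennreal (v * m powr (1 / p)) \<le> Lp_norm N (ennreal p) F"
proof -
  define I where "I = (\<integral>\<^sup>+ x. ennreal (norm (F x) powr p) \<partial>N)"
  have "ennreal (v powr p * m) = (\<integral>\<^sup>+ x. ennreal (v powr p) * indicator E x \<partial>N)"
    using E by (simp add: nn_integral_cmult_indicator ennreal_mult)
  also have "\<dots> \<le> I"
    unfolding I_def using v p
    by (intro nn_integral_mono) (auto simp: indicator_def intro!: ennreal_leI powr_mono2)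
  finally have le: "ennreal (v powr p * m) \<le> I" .
  show ?thesis
  proof (cases "I = \<infinity>")
    case True
    then show ?thesis using p by (simp add: Lp_norm_def I_def)
  next
    case False
    then obtain i where i: "I = ennreal i" "0 \<le> i"
      by (cases I) auto
    with le have "v powr p * m \<le> i" by (simp add: ennreal_le_iff)
    then have "(v powr p * m) powr (1 / p) \<le> i powr (1 / p)"
      using E p by (intro powr_mono2) auto
    moreover have "(v powr p * m) powr (1 / p) = v * m powr (1 / p)"
      using v E p by (simp add: powr_mult powr_powr)
    ultimately have "ennreal (v * m powr (1 / p)) \<le> ennreal (i powr (1 / p))"
      by (simp add: ennreal_leI)
    then show ?thesis
      using p False i by (simp add: Lp_norm_def I_def[symmetric] Let_def)
  qed
qed

lemma Lp_norm_infinity_ge: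
  assumes E: "E \<in> sets N" "emeasure N E \<noteq> 0"
    and v: "\<And>x. x \<in> E \<Longrightarrow> v \<le> norm (F x)"
  shows "ennreal v \<le> Lp_norm N \<infinity> F"
proof (rule ccontr)
  assume "\<not> ?thesis"
  then have lt: "esssup N (\<lambda>x. ennreal (norm (F x))) < ennreal v"
    by (simp add: Lp_norm_def not_le)
  have "AE x in N. x \<notin> E"
    using esssup_AE[of "\<lambda>x. ennreal (norm (F x))" N]
  proof eventually_elim
    case (elim x)
    with lt have "norm (F x) < v"
      by (meson ennreal_leI leD le_less_trans not_le_imp_less)
    then show ?case using v by fastforce
  qed
  then have "emeasure N E = 0"
    using E(1) by (subst (asm) AE_iff_measurable[OF E(1)]) (auto dest: sets.sets_into_space)
  then show False using E(2) by simp
qed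

lemma Lp_norm_eqI:
  assumes "0 < p" "(\<integral>\<^sup>+ x. ennreal (norm (F x) powr p) \<partial>N) = ennreal i" "0 \<le> i"
  shows "Lp_norm N (ennreal p) F = ennreal (i powr (1 / p))"
  using assms by (simp add: Lp_norm_def)

section \<open>Lower bounds for Fourier transforms on dual boxes\<close>

lemma cos_ge_quadratic: "1 - x\<^sup>2 / 2 \<le> cos (x::real)"
proof -
  have "cos x = 1 - 2 * (sin (x / 2))\<^sup>2"
    using cos_double_sin[of "x / 2"] by simp
  moreover have "(sin (x / 2))\<^sup>2 \<le> (x / 2)\<^sup>2"
    by (metis abs_sin_x_le_abs_x abs_le_square_iff)
  ultimately show ?thesis by (simp add: power2_eq_square)
qed

text \<open>The norm dominates the real part, in which cos \<theta> \<ge> 1 - \<theta>^2 / 2 is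
  integrated against \<open>g\<close>. The majorant \<open>h\<close> of the quadratic error is left
  free: it becomes half the indicator in \<open>extension_norm_ge\<close> and a multiple of the
  square root of the Gaussian in \<open>fourier_gauss_ge\<close>.\<close>

lemma fourier_lower:
  fixes N :: "'a::euclidean_space measure" and g h :: "'a \<Rightarrow> real"
  assumes N: "sets N = sets borel" and g: "integrable N g" "\<And>x. 0 \<le> g x" and h: "integrable N h"
    and le: "\<And>x. (2 * pi * (\<xi> \<bullet> x))\<^sup>2 / 2 * g x \<le> h x"
  shows "(\<integral>x. g x \<partial>N) - (\<integral>x. h x \<partial>N) \<le> norm (fourier N (\<lambda>x. of_real (g x)) \<xi>)"
proof -
  let ?e = "\<lambda>x. exp (- 2 * of_real pi * \<i> * of_real (\<xi> \<bullet> x)) :: complex"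
  have ecis: "?e x = cis (- (2 * pi * (\<xi> \<bullet> x)))" for x
    by (simp add: cis_conv_exp mult_ac)
  have [measurable]: "(\<lambda>x. \<xi> \<bullet> x) \<in> borel_measurable N"
    using N by (subst measurable_cong_sets[OF N refl]) simp
  have [measurable]: "g \<in> borel_measurable N" using g by simp
  have int: "integrable N (\<lambda>x. ?e x * of_real (g x))"
    by (rule Bochner_Integration.integrable_bound[OF g(1)]) (auto simp: norm_mult ecis)
  have intc: "integrable N (\<lambda>x. cos (2 * pi * (\<xi> \<bullet> x)) * g x)"
    by (rule Bochner_Integration.integrable_bound[OF g(1)]) (auto simp: abs_mult intro!: mult_left_le_one_le)
  have "(\<integral>x. g x \<partial>N) - (\<integral>x. h x \<partial>N) = (\<integral>x. g x - h x \<partial>N)"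
    using g h by simp
  also have "\<dots> \<le> (\<integral>x. cos (2 * pi * (\<xi> \<bullet> x)) * g x \<partial>N)"
  proof (rule integral_mono[OF _ intc])
    show "integrable N (\<lambda>x. g x - h x)" using g h by simp
    fix x
    have "(1 - (2 * pi * (\<xi> \<bullet> x))\<^sup>2 / 2) * g x \<le> cos (2 * pi * (\<xi> \<bullet> x)) * g x"
      by (intro mult_right_mono cos_ge_quadratic g)
    then show "g x - h x \<le> cos (2 * pi * (\<xi> \<bullet> x)) * g x"
      using le[of x] by (simp add: algebra_simps)
  qed
  also have "\<dots> = Re (fourier N (\<lambda>x. of_real (g x)) \<xi>)"
    unfolding fourier_def ecis by (subst integral_Re[OF int[unfolded ecis], symmetric]) simp
  also have "\<dots> \<le> norm (fourier N (\<lambda>x. of_real (g x)) \<xi>)"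
    by (rule complex_Re_le_cmod)
  finally show ?thesis .
qed

text \<open>Half-widths are indexed by the basis vectors, so that passing to a dual box means taking
  reciprocals coordinate by coordinate, up to a constant.\<close>

definition coord_box :: "('a::euclidean_space \<Rightarrow> real) \<Rightarrow> 'a set" where
  "coord_box d = {x. \<forall>b\<in>Basis. \<bar>x \<bullet> b\<bar> \<le> d b}"

lemma coord_box_cbox: "coord_box d = cbox (\<Sum>b\<in>Basis. - d b *\<^sub>R b) (\<Sum>b\<in>Basis. d b *\<^sub>R b)"
  by (auto simp: coord_box_def mem_box abs_le_iff minus_le_iff sum_negf)

lemma emeasure_coord_box:
  assumes "\<And>b. b \<in> Basis \<Longrightarrow> 0 \<le> d b"
  shows "emeasure lborel (coord_box d :: 'a::euclidean_space set) = ennreal (\<Prod>b\<in>Basis. 2 * d (b::'a))"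
  using assms unfolding coord_box_cbox
  by (subst emeasure_lborel_cbox) (auto simp: algebra_simps sum_negf intro!: arg_cong[where f=ennreal] prod.cong)

lemma inner_square_le:
  fixes x y :: "'a::euclidean_space"
  shows "(x \<bullet> y)\<^sup>2 \<le> DIM('a) * (\<Sum>b\<in>Basis. ((x \<bullet> b) * (y \<bullet> b))\<^sup>2)"
  using sum_squared_le_sum_of_squares[of "\<lambda>b. (x \<bullet> b) * (y \<bullet> b)" "Basis :: 'a set"]
  by (simp add: euclidean_inner[of x y] mult.commute)

text \<open>On a suitable box dual to \<open>coord_box d\<close> the phase stays within [-1, 1] for
  all points of \<open>E\<close>, so there is little cancellation and at least half of the mass
  \<open>m\<close> survives in the transform. The base of the power 1 / q is the volume of that dual
  box.\<close>

lemma extension_norm_ge: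
  fixes N :: "'a::euclidean_space measure"
  assumes N: "sets N = sets borel" and E: "E \<in> sets borel" "emeasure N E = ennreal m" "0 \<le> m"
    and sub: "E \<subseteq> coord_box d" and d: "\<And>b. b \<in> Basis \<Longrightarrow> 0 < d b" and q: "0 < q"
  shows "ennreal (m / 2 * ((1 / (pi * DIM('a))) ^ DIM('a) / (\<Prod>b\<in>Basis. d (b::'a))) powr (1 / q))
    \<le> Lp_norm lborel (ennreal q) (fourier N (indicator E))"
proof -
  have dn: "0 < real DIM('a)" by simp
  \<comment> \<open>Each of the \<open>DIM('a)\<close> coordinates contributes at most 1 / (2 pi
    DIM) to the inner product of \<xi> with a point of \<open>coord_box d\<close>, which gives |2 pi
    (\<xi> \<bullet> x)| \<le> 1.\<close>
  define R where "R = (coord_box (\<lambda>b. 1 / (2 * pi * DIM('a) * d b)) :: 'a set)"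
  have R: "emeasure lborel R = ennreal ((1 / (pi * DIM('a))) ^ DIM('a) / (\<Prod>b\<in>Basis. d (b::'a)))"
  proof -
    have "(\<Prod>b\<in>(Basis::'a set). 2 * (1 / (2 * pi * DIM('a) * d b))) = (\<Prod>b\<in>(Basis::'a set). 1 / (pi * DIM('a)) / d b)"
      by (simp add: mult.assoc)
    also have "\<dots> = (1 / (pi * DIM('a))) ^ DIM('a) / (\<Prod>b\<in>Basis. d (b::'a))"
      by (subst prod_dividef) (simp only: prod_constant)
    finally have eq: "(\<Prod>b\<in>(Basis::'a set). 2 * (1 / (2 * pi * DIM('a) * d b)))
      = (1 / (pi * DIM('a))) ^ DIM('a) / (\<Prod>b\<in>Basis. d (b::'a))" .
    have "0 \<le> 1 / (2 * pi * DIM('a) * d b)" if "b \<in> Basis" for b :: 'a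
      using d[OF that] by simp
    then have "emeasure lborel R = ennreal (\<Prod>b\<in>(Basis::'a set). 2 * (1 / (2 * pi * DIM('a) * d b)))"
      unfolding R_def by (rule emeasure_coord_box)
    then show ?thesis unfolding eq .
  qed
  have [measurable]: "E \<in> sets N" using N E by simp
  have int: "integrable N (indicator E :: 'a \<Rightarrow> real)" using E
    by (simp add: integrable_indicator_iff)
  have iE: "(\<integral>x. indicator E x \<partial>N) = m"
    using E by (simp add: measure_def)
  have low: "m / 2 \<le> norm (fourier N (indicator E) \<xi>)" if "\<xi> \<in> R" for \<xi>
  proof -
    have "(2 * pi * (\<xi> \<bullet> x))\<^sup>2 / 2 * indicator E x \<le> indicator E x / 2" for x
    proof (cases "x \<in> E")
      case True
      with sub have x: "x \<in> coord_box d" by auto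
      have "\<bar>\<xi> \<bullet> x\<bar> \<le> (\<Sum>b\<in>Basis. \<bar>\<xi> \<bullet> b\<bar> * \<bar>x \<bullet> b\<bar>)"
        unfolding euclidean_inner[of \<xi> x] by (rule order_trans[OF sum_abs]) (simp add: abs_mult)
      also have "\<dots> \<le> (\<Sum>b\<in>(Basis::'a set). 1 / (2 * pi * DIM('a) * d b) * d b)"
        using x that d by (intro sum_mono mult_mono) (auto simp: coord_box_def R_def less_imp_le)
      also have "\<dots> = (\<Sum>b\<in>(Basis::'a set). 1 / (2 * pi * DIM('a)))"
        using d by (intro sum.cong) (auto simp: less_imp_neq[symmetric] dest!: d)
      also have "\<dots> = 1 / (2 * pi)" using dn by (simp add: field_simps)
      finally have "\<bar>2 * pi * (\<xi> \<bullet> x)\<bar> \<le> 1" by (simp add: abs_mult field_simps)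
      then have "(2 * pi * (\<xi> \<bullet> x))\<^sup>2 \<le> 1" by (simp add: abs_square_le_1)
      then show ?thesis using True by simp
    qed simp
    from fourier_lower[OF N int _ _ this] int iE
    have "m / 2 \<le> norm (fourier N (\<lambda>x. of_real (indicator E x)) \<xi>)" by simp
    moreover have "(\<lambda>x. complex_of_real (indicator E x)) = indicator E"
      by (simp add: of_real_indicator fun_eq_iff)
    ultimately show ?thesis by simp
  qed
  have "0 < (1 / (pi * DIM('a))) ^ DIM('a) / (\<Prod>b\<in>Basis. d (b::'a))"
    using d by (auto intro!: divide_pos_pos prod_pos)
  from Lp_norm_ge[OF _ R this _ low q] E show ?thesis
    by (simp add: R_def coord_box_cbox)
qed

section \<open>Gaussians\<close>

text \<open>The width in direction \<open>b\<close> is of order 1 / c b, so the Fourier transform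
  lives at scale \<open>c b\<close>: the rates prescribe, up to a constant, the box on which the
  transform is to be large.\<close>

definition gauss :: "('a::euclidean_space \<Rightarrow> real) \<Rightarrow> 'a \<Rightarrow> real" where
  "gauss c x = exp (- (\<Sum>b\<in>Basis. (c b * (x \<bullet> b))\<^sup>2))"

lemma nn_integral_gauss_real:
  assumes "0 < a"
  shows "(\<integral>\<^sup>+x. ennreal (exp (- (a * x)\<^sup>2)) \<partial>lborel) = ennreal (sqrt pi / a)"
proof -
  \<comment> \<open>Chosen so that 2 s^2 = 1 / a^2, which makes the integrand a multiple of the
    normal density with standard deviation \<open>s\<close>.\<close>
  define s where "s = 1 / (a * sqrt 2)"
  have s: "0 < s" using assms by (simp add: s_def)
  have eq: "exp (- (a * x)\<^sup>2) = sqrt pi / a * normal_density 0 s x" for x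
    using assms by (simp add: normal_density_def s_def power_divide power_mult_distrib
      real_sqrt_mult real_sqrt_divide mult.commute)
  show ?thesis
    unfolding eq using s assms
    by (simp add: ennreal_mult nn_integral_cmult nn_integral_eq_integral)
qed

text \<open>The power \<open>r\<close> multiplies every rate by sqrt r, and the integral factors
  over the coordinates. The cases r = 1 and r = 1/2 give the mass and the error term in
  \<open>fourier_gauss_ge\<close>; general \<open>r\<close> gives the Lebesgue norm in
  \<open>gauss_Lp_norm\<close>.\<close>

lemma nn_integral_gauss:
  fixes c :: "'a::euclidean_space \<Rightarrow> real"
  assumes c: "\<And>b. b \<in> Basis \<Longrightarrow> 0 < c b" and r: "0 < r"
  shows "(\<integral>\<^sup>+x. ennreal (gauss c x powr r) \<partial>lborel)
    = ennreal (sqrt (pi / r) ^ DIM('a) / (\<Prod>b\<in>Basis. c b))"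
proof -
  have "gauss c x powr r = (\<Prod>b\<in>Basis. exp (- (sqrt r * c b * (x \<bullet> b))\<^sup>2))" for x
    using r by (simp add: gauss_def powr_def exp_sum[symmetric] sum_negf[symmetric] sum_distrib_left
      power_mult_distrib mult_ac)
  then have "(\<integral>\<^sup>+x. ennreal (gauss c x powr r) \<partial>lborel)
      = (\<integral>\<^sup>+x. (\<Prod>b\<in>Basis. ennreal (exp (- (sqrt r * c b * (x \<bullet> b))\<^sup>2))) \<partial>lborel)"
    by (simp add: prod_ennreal)
  also have "\<dots> = (\<Prod>b\<in>Basis. \<integral>\<^sup>+x. ennreal (exp (- (sqrt r * c b * x)\<^sup>2)) \<partial>lborel)"
    by (rule nn_integral_lborel_prod) auto
  also have "\<dots> = (\<Prod>b\<in>Basis. ennreal (sqrt pi / (sqrt r * c b)))"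
    using c r by (intro prod.cong refl nn_integral_gauss_real) auto
  also have "\<dots> = ennreal (\<Prod>b\<in>Basis. sqrt (pi / r) / c b)"
    using c r by (subst prod_ennreal) (auto simp: less_imp_le real_sqrt_divide)
  finally show ?thesis by (simp add: prod_dividef)
qed

lemma
  fixes c :: "'a::euclidean_space \<Rightarrow> real"
  assumes c: "\<And>b. b \<in> Basis \<Longrightarrow> 0 < c b" and r: "0 < r"
  shows integrable_gauss_powr: "integrable lborel (\<lambda>x. gauss c x powr r)"
    and integral_gauss_powr: "(\<integral>x. gauss c x powr r \<partial>lborel)
      = sqrt (pi / r) ^ DIM('a) / (\<Prod>b\<in>Basis. c b)"
proof -
  have [measurable]: "gauss c \<in> borel_measurable lborel"
    unfolding gauss_def by measurable
  have "0 \<le> sqrt (pi / r) ^ DIM('a) / (\<Prod>b\<in>Basis. c b)"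
    using r by (auto intro!: divide_nonneg_nonneg prod_nonneg simp: c less_imp_le)
  then have "has_bochner_integral lborel (\<lambda>x. gauss c x powr r) (sqrt (pi / r) ^ DIM('a) / (\<Prod>b\<in>Basis. c b))"
    using nn_integral_gauss[of c r, OF c r] by (intro has_bochner_integral_nn_integral) auto
  then show "integrable lborel (\<lambda>x. gauss c x powr r)"
    "(\<integral>x. gauss c x powr r \<partial>lborel) = sqrt (pi / r) ^ DIM('a) / (\<Prod>b\<in>Basis. c b)"
    by (auto simp: has_bochner_integral_iff)
qed

text \<open>The point is that \<kappa> depends on the dimension only, uniformly over all anisotropic
  rates \<open>c\<close>. With Q the quadratic form in the exponent, Cauchy-Schwarz bounds the
  squared inner product by n \<kappa>^2 Q, and Q exp (-Q) \<le> 2 exp (-Q / 2) trades the factor Q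
  for half of the decay, so that the error is again a Gaussian integral.\<close>

lemma fourier_gauss_ge:
  "\<exists>\<kappa>>0::real. \<forall>(c::'a::euclidean_space \<Rightarrow> real) \<xi>.
     (\<forall>b\<in>Basis. 0 < c b) \<longrightarrow> \<xi> \<in> coord_box (\<lambda>b. \<kappa> * c b) \<longrightarrow>
     sqrt pi ^ DIM('a) / (2 * (\<Prod>b\<in>Basis. c b)) \<le> norm (fourier lborel (\<lambda>x. of_real (gauss c x)) \<xi>)"
proof -
  define n where "n = DIM('a)"
  have n: "0 < n" by (simp add: n_def)
  \<comment> \<open>The square root of the Gaussian has sqrt 2 ^ n times the integral of the
    Gaussian; this \<kappa> makes the integral of the error term exactly half of the total
    mass.\<close>
  define \<kappa> where "\<kappa> = sqrt (1 / (8 * pi\<^sup>2 * n * sqrt 2 ^ n))"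
  have \<kappa>: "0 < \<kappa>" "4 * pi\<^sup>2 * n * \<kappa>\<^sup>2 * sqrt 2 ^ n = 1 / 2"
    using n by (auto simp: \<kappa>_def field_simps)
  show ?thesis
  proof (intro exI[of _ \<kappa>] conjI allI impI \<kappa>)
    fix c :: "'a \<Rightarrow> real" and \<xi> :: 'a
    assume c: "\<forall>b\<in>Basis. 0 < c b" and \<xi>: "\<xi> \<in> coord_box (\<lambda>b. \<kappa> * c b)"
    define h where "h x = 4 * pi\<^sup>2 * n * \<kappa>\<^sup>2 * gauss c x powr (1 / 2)" for x
    have c': "0 < c b" if "b \<in> Basis" for b using c that by auto
    have le: "(2 * pi * (\<xi> \<bullet> x))\<^sup>2 / 2 * gauss c x \<le> h x" for x
    proof -
      define Q where "Q = (\<Sum>b\<in>Basis. (c b * (x \<bullet> b))\<^sup>2)"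
      have Q: "0 \<le> Q" by (simp add: Q_def sum_nonneg)
      have "(\<xi> \<bullet> x)\<^sup>2 \<le> n * (\<Sum>b\<in>Basis. ((\<xi> \<bullet> b) * (x \<bullet> b))\<^sup>2)"
        unfolding n_def by (rule inner_square_le)
      also have "\<dots> \<le> n * (\<Sum>b\<in>Basis. \<kappa>\<^sup>2 * (c b * (x \<bullet> b))\<^sup>2)"
      proof (intro mult_left_mono sum_mono)
        fix b :: 'a assume b: "b \<in> Basis"
        then have "\<bar>\<xi> \<bullet> b\<bar>\<^sup>2 \<le> (\<kappa> * c b)\<^sup>2"
          using \<xi> by (intro power_mono) (auto simp: coord_box_def)
        then show "((\<xi> \<bullet> b) * (x \<bullet> b))\<^sup>2 \<le> \<kappa>\<^sup>2 * (c b * (x \<bullet> b))\<^sup>2"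
          by (simp add: power_mult_distrib mult.assoc[symmetric] mult_right_mono)
      qed simp
      also have "\<dots> = n * \<kappa>\<^sup>2 * Q" by (simp add: Q_def sum_distrib_left mult.assoc)
      finally have 1: "(\<xi> \<bullet> x)\<^sup>2 \<le> n * \<kappa>\<^sup>2 * Q" .
      have "Q / 2 \<le> exp (Q / 2)" using exp_ge_add_one_self[of "Q / 2"] by linarith
      then have "Q * exp (- Q) \<le> (2 * exp (Q / 2)) * exp (- Q)"
        by (intro mult_right_mono) auto
      also have "\<dots> = 2 * exp (- Q / 2)" by (simp add: exp_add[symmetric])
      finally have 2: "Q * exp (- Q) \<le> 2 * exp (- Q / 2)" .
      have "(2 * pi * (\<xi> \<bullet> x))\<^sup>2 / 2 * gauss c x = 2 * pi\<^sup>2 * (\<xi> \<bullet> x)\<^sup>2 * exp (- Q)"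
        by (simp add: power_mult_distrib gauss_def Q_def)
      also have "\<dots> \<le> 2 * pi\<^sup>2 * (n * \<kappa>\<^sup>2 * Q) * exp (- Q)"
        using 1 by (intro mult_right_mono mult_left_mono) auto
      also have "\<dots> = 2 * pi\<^sup>2 * n * \<kappa>\<^sup>2 * (Q * exp (- Q))" by simp
      also have "\<dots> \<le> 2 * pi\<^sup>2 * n * \<kappa>\<^sup>2 * (2 * exp (- Q / 2))"
        using 2 by (intro mult_left_mono) auto
      also have "\<dots> = h x" by (simp add: h_def gauss_def Q_def powr_def)
      finally show ?thesis .
    qed
    have g1: "integrable lborel (gauss c)" "(\<integral>x. gauss c x \<partial>lborel) = sqrt pi ^ n / (\<Prod>b\<in>Basis. c b)"
      using integrable_gauss_powr[of c 1, OF c'] integral_gauss_powr[of c 1, OF c']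
      by (simp_all add: n_def gauss_def[abs_def])
    have h1: "integrable lborel h"
      unfolding h_def by (intro integrable_mult_right integrable_gauss_powr c') auto
    have "(\<integral>x. h x \<partial>lborel) = 4 * pi\<^sup>2 * n * \<kappa>\<^sup>2 * (sqrt (2 * pi) ^ n / (\<Prod>b\<in>Basis. c b))"
      unfolding h_def using integral_gauss_powr[of c "1/2", OF c'] by (simp add: n_def mult.commute)
    also have "\<dots> = (4 * pi\<^sup>2 * n * \<kappa>\<^sup>2 * sqrt 2 ^ n) * (sqrt pi ^ n / (\<Prod>b\<in>Basis. c b))"
      by (simp add: real_sqrt_mult power_mult_distrib)
    also have "\<dots> = sqrt pi ^ n / (2 * (\<Prod>b\<in>Basis. c b))"
      unfolding \<kappa> by simp
    finally have h2: "(\<integral>x. h x \<partial>lborel) = sqrt pi ^ n / (2 * (\<Prod>b\<in>Basis. c b))" .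
    have "(\<integral>x. gauss c x \<partial>lborel) - (\<integral>x. h x \<partial>lborel) \<le> norm (fourier lborel (\<lambda>x. of_real (gauss c x)) \<xi>)"
      by (rule fourier_lower[OF _ g1(1) _ h1 le]) (auto simp: gauss_def)
    then show "sqrt pi ^ DIM('a) / (2 * (\<Prod>b\<in>Basis. c b)) \<le> norm (fourier lborel (\<lambda>x. of_real (gauss c x)) \<xi>)"
      by (simp add: g1 h2 n_def[symmetric])
  qed
qed

section \<open>Gaussians are Schwartz functions\<close>

lemma polynomial_has_derivative:
  fixes P :: "'a::euclidean_space \<Rightarrow> real"
  assumes "real_polynomial_function P"
  shows "\<exists>P'. (\<forall>x. (P has_derivative P' x) (at x)) \<and> (\<forall>v. real_polynomial_function (\<lambda>x. P' x v))"
  using assms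
proof induction
  case (linear f)
  then show ?case
    by (intro exI[of _ "\<lambda>x. f"]) (auto intro: bounded_linear_imp_has_derivative)
next
  case (const c)
  then show ?case
    by (intro exI[of _ "\<lambda>x v. 0"]) auto
next
  case (add f g)
  then obtain f' g' where *: "\<And>x. (f has_derivative f' x) (at x)" "\<And>v. real_polynomial_function (\<lambda>x. f' x v)"
      "\<And>x. (g has_derivative g' x) (at x)" "\<And>v. real_polynomial_function (\<lambda>x. g' x v)"
    by blast
  then show ?case
    by (intro exI[of _ "\<lambda>x v. f' x v + g' x v"]) (auto intro!: has_derivative_add)
next
  case (mult f g)
  then obtain f' g' where *: "\<And>x. (f has_derivative f' x) (at x)" "\<And>v. real_polynomial_function (\<lambda>x. f' x v)"
      "\<And>x. (g has_derivative g' x) (at x)" "\<And>v. real_polynomial_function (\<lambda>x. g' x v)"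
    by blast
  then show ?case using mult.hyps
    by (intro exI[of _ "\<lambda>x v. f x * g' x v + f' x v * g x"]) (auto intro!: has_derivative_mult real_polynomial_function.intros(3,4))
qed

text \<open>The base 1 + norm x is at least 1, so exponents can be raised to a common one for sums
  and simply add up for products.\<close>

lemma polynomial_bounded:
  fixes P :: "'a::euclidean_space \<Rightarrow> real"
  assumes "real_polynomial_function P"
  shows "\<exists>C m. 0 \<le> C \<and> (\<forall>x. \<bar>P x\<bar> \<le> C * (1 + norm x) ^ m)"
  using assms
proof induction
  case (linear f)
  then obtain K where K: "0 < K" "\<And>x. norm (f x) \<le> norm x * K"
    using bounded_linear.pos_bounded by blast
  have "\<bar>f x\<bar> \<le> K * (1 + norm x) ^ 1" for x
    using K(1) K(2)[of x] by (simp add: algebra_simps)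
  then show ?case using K by (meson less_imp_le)
next
  case (const c)
  then show ?case by (intro exI[of _ "\<bar>c\<bar>"] exI[of _ 0]) auto
next
  case (add f g)
  then obtain C m D n where *: "0 \<le> C" "\<And>x. \<bar>f x\<bar> \<le> C * (1 + norm x) ^ m"
    "0 \<le> D" "\<And>x. \<bar>g x\<bar> \<le> D * (1 + norm x) ^ n" by blast
  have "\<bar>f x + g x\<bar> \<le> (C + D) * (1 + norm x) ^ (m + n)" for x
  proof -
    have "\<bar>f x + g x\<bar> \<le> C * (1 + norm x) ^ m + D * (1 + norm x) ^ n"
      using *(2)[of x] *(4)[of x] by linarith
    also have "\<dots> \<le> C * (1 + norm x) ^ (m + n) + D * (1 + norm x) ^ (m + n)"
      using * by (intro add_mono mult_left_mono power_increasing) auto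
    finally show ?thesis by (simp add: algebra_simps)
  qed
  then show ?case using * by (intro exI[of _ "C + D"] exI[of _ "m + n"]) auto
next
  case (mult f g)
  then obtain C m D n where *: "0 \<le> C" "\<And>x. \<bar>f x\<bar> \<le> C * (1 + norm x) ^ m"
    "0 \<le> D" "\<And>x. \<bar>g x\<bar> \<le> D * (1 + norm x) ^ n" by blast
  have "\<bar>f x * g x\<bar> \<le> (C * D) * (1 + norm x) ^ (m + n)" for x
  proof -
    have "\<bar>f x * g x\<bar> \<le> (C * (1 + norm x) ^ m) * (D * (1 + norm x) ^ n)"
      unfolding abs_mult using * by (intro mult_mono) auto
    then show ?thesis by (simp add: power_add mult_ac)
  qed
  then show ?case using * by (intro exI[of _ "C * D"] exI[of _ "m + n"]) auto
qed

text \<open>The limit 0 at infinity bounds the tail by 1, and compactness bounds the remaining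
  interval.\<close>

lemma polynomial_times_gaussian_bounded:
  assumes "0 < a"
  shows "\<exists>K. \<forall>r\<ge>0::real. (1 + r) ^ n * exp (- a * r\<^sup>2) \<le> K"
proof -
  have "((\<lambda>r. (1 + r) ^ n * exp (- a * r\<^sup>2)) \<longlongrightarrow> 0) at_top"
    using assms by real_asymp
  then have "eventually (\<lambda>r. (1 + r) ^ n * exp (- a * r\<^sup>2) < 1) at_top"
    by (rule order_tendstoD) simp
  then obtain R where R: "\<And>r. R \<le> r \<Longrightarrow> (1 + r) ^ n * exp (- a * r\<^sup>2) < 1"
    by (auto simp: eventually_at_top_linorder)
  have "compact ((\<lambda>r. (1 + r) ^ n * exp (- a * r\<^sup>2)) ` {0..max 0 R})"
    by (intro compact_continuous_image continuous_intros) auto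
  then obtain K where K: "\<And>r. r \<in> {0..max 0 R} \<Longrightarrow> norm ((1 + r) ^ n * exp (- a * r\<^sup>2)) \<le> K"
    by (force dest!: compact_imp_bounded simp: bounded_iff)
  have "(1 + r) ^ n * exp (- a * r\<^sup>2) \<le> max 1 K" if "0 \<le> r" for r
  proof (cases "R \<le> r")
    case True
    then show ?thesis using R[of r] by simp
  next
    case False
    then show ?thesis using K[of r] that by auto
  qed
  then show ?thesis by blast
qed

lemma real_polynomial_function_inner: "real_polynomial_function (\<lambda>x. x \<bullet> v)"
  by (rule real_polynomial_function.intros(1)) (rule bounded_linear_inner_left)

lemma has_derivative_gauss:
  fixes c :: "'a::euclidean_space \<Rightarrow> real"
  shows "(gauss c has_derivative (\<lambda>v. gauss c x * (- (\<Sum>b\<in>Basis. 2 * (c b)\<^sup>2 * (x \<bullet> b) * (v \<bullet> b))))) (at x)"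
proof -
  have "((\<lambda>x. (c b * (x \<bullet> b))\<^sup>2) has_derivative (\<lambda>v. 2 * (c b)\<^sup>2 * (x \<bullet> b) * (v \<bullet> b))) (at x)" for b
  proof -
    have "((\<lambda>x. c b * (x \<bullet> b)) has_derivative (\<lambda>v. c b * (v \<bullet> b))) (at x)"
      by (intro has_derivative_mult_right has_derivative_inner_left has_derivative_ident)
    from has_derivative_mult[OF this this] show ?thesis
      by (simp add: power2_eq_square algebra_simps)
  qed
  then have "((\<lambda>x. - (\<Sum>b\<in>Basis. (c b * (x \<bullet> b))\<^sup>2)) has_derivative
      (\<lambda>v. - (\<Sum>b\<in>Basis. 2 * (c b)\<^sup>2 * (x \<bullet> b) * (v \<bullet> b)))) (at x)"
    by (intro has_derivative_minus has_derivative_sum)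
  from has_derivative_exp[OF this] show ?thesis
    by (simp add: gauss_def[abs_def] mult.commute)
qed

text \<open>The smallest rate governs the decay. The radial bound reduces the Schwartz estimates to
  a function of one real variable.\<close>

lemma gauss_le:
  fixes c :: "'a::euclidean_space \<Rightarrow> real"
  assumes c: "\<And>b. b \<in> Basis \<Longrightarrow> 0 < c b"
  shows "\<exists>a>0. \<forall>x. gauss c x \<le> exp (- a * (norm x)\<^sup>2)"
proof -
  define a where "a = (Min (c ` Basis))\<^sup>2"
  have m: "0 < Min (c ` Basis)" using c by (subst Min_gr_iff) auto
  have "a * (norm x)\<^sup>2 \<le> (\<Sum>b\<in>Basis. (c b * (x \<bullet> b))\<^sup>2)" for x
  proof -
    have "a * (norm x)\<^sup>2 = (\<Sum>b\<in>Basis. a * (x \<bullet> b)\<^sup>2)"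
      unfolding power2_norm_eq_inner euclidean_inner[of x x] by (simp add: power2_eq_square sum_distrib_left)
    also have "\<dots> \<le> (\<Sum>b\<in>Basis. (c b * (x \<bullet> b))\<^sup>2)"
      unfolding power_mult_distrib a_def using m
      by (intro sum_mono mult_right_mono power_mono) auto
    finally show ?thesis .
  qed
  moreover have "0 < a" using m unfolding a_def by (rule zero_less_power)
  ultimately show ?thesis by (intro exI[of _ a]) (auto simp: gauss_def)
qed

text \<open>Polynomial multiples of a fixed Gaussian are closed under partial derivatives, so every
  iterated derivative has this form, and its polynomial growth loses against the radial
  decay.\<close>

lemma schwartz_gauss:
  fixes c :: "'a::euclidean_space \<Rightarrow> real"
  assumes c: "\<And>b. b \<in> Basis \<Longrightarrow> 0 < c b"
  shows "schwartz (\<lambda>x. of_real (gauss c x))"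
proof -
  have partial: "\<exists>P. real_polynomial_function P \<and>
      iterated_partial bs (\<lambda>x. of_real (gauss c x)) = (\<lambda>x. of_real (P x * gauss c x))" for bs
  proof (induction bs)
    case Nil
    then show ?case by (intro exI[of _ "\<lambda>x. 1"]) auto
  next
    case (Cons v bs)
    then obtain P where P: "real_polynomial_function P"
      and eq: "iterated_partial bs (\<lambda>x. of_real (gauss c x)) = (\<lambda>x. of_real (P x * gauss c x))" by blast
    from polynomial_has_derivative[OF P] obtain P' where
      P': "\<And>x. (P has_derivative P' x) (at x)" "\<And>v. real_polynomial_function (\<lambda>x. P' x v)" by blast
    \<comment> \<open>The logarithmic derivative of the Gaussian in direction \<open>v\<close>,
      which is a polynomial; by the product rule the new polynomial factor is P S + P'.\<close>
    define S where "S = (\<lambda>x. - (\<Sum>b\<in>Basis. 2 * (c b)\<^sup>2 * (x \<bullet> b) * (v \<bullet> b)))"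
    have S: "real_polynomial_function S"
      unfolding S_def
      by (intro real_polynomial_function_minus real_polynomial_function_sum real_polynomial_function.intros(2,4)
          real_polynomial_function_inner) auto
    have "frechet_derivative (\<lambda>x. complex_of_real (P x * gauss c x)) (at x) v
      = of_real ((P x * S x + P' x v) * gauss c x)" for x
    proof -
      have "((\<lambda>x. complex_of_real (P x * gauss c x)) has_derivative
        (\<lambda>v. of_real (P x * (gauss c x * (- (\<Sum>b\<in>Basis. 2 * (c b)\<^sup>2 * (x \<bullet> b) * (v \<bullet> b)))) + P' x v * gauss c x))) (at x)"
        by (intro has_derivative_of_real has_derivative_mult P' has_derivative_gauss)
      from frechet_derivative_at[OF this, symmetric] show ?thesis
        by (simp add: S_def algebra_simps)
    qed
    then have "iterated_partial (v # bs) (\<lambda>x. of_real (gauss c x)) =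
        (\<lambda>x. of_real ((P x * S x + P' x v) * gauss c x))"
      by (simp add: eq fun_eq_iff)
    moreover have "real_polynomial_function (\<lambda>x. P x * S x + P' x v)"
      by (rule real_polynomial_function.intros(3)[OF real_polynomial_function.intros(4)[OF P S] P'(2)])
    ultimately show ?case by blast
  qed
  obtain a where a: "0 < a" "\<And>x. gauss c x \<le> exp (- a * (norm x)\<^sup>2)"
    using gauss_le[of c, OF c] by blast
  show ?thesis unfolding schwartz_def
  proof (intro allI impI conjI)
    fix bs :: "'a list"
    from partial[of bs] obtain P where P: "real_polynomial_function P"
      and eq: "iterated_partial bs (\<lambda>x. of_real (gauss c x)) = (\<lambda>x. of_real (P x * gauss c x))" by blast
    from polynomial_has_derivative[OF P] obtain P' where
      P': "\<And>x. (P has_derivative P' x) (at x)" by blast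
    have "(\<lambda>x. complex_of_real (P x * gauss c x)) differentiable (at x)" for x
      using has_derivative_of_real[OF has_derivative_mult[OF P' has_derivative_gauss]]
      by (rule differentiableI)
    then show "iterated_partial bs (\<lambda>x. of_real (gauss c x)) differentiable_on UNIV"
      unfolding eq by (simp add: differentiable_on_def)
    fix n :: nat
    from polynomial_bounded[OF P] obtain C m where C: "0 \<le> C" "\<And>x. \<bar>P x\<bar> \<le> C * (1 + norm x) ^ m" by blast
    from polynomial_times_gaussian_bounded[OF a(1), of "n + m"] obtain K where
      K: "\<And>r. 0 \<le> r \<Longrightarrow> (1 + r) ^ (n + m) * exp (- a * r\<^sup>2) \<le> K" by blast
    have "norm (norm x ^ n *\<^sub>R complex_of_real (P x * gauss c x)) \<le> C * K" for x
    proof -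
      have "norm (norm x ^ n *\<^sub>R complex_of_real (P x * gauss c x)) = norm x ^ n * \<bar>P x\<bar> * gauss c x"
        by (simp add: norm_mult gauss_def)
      also have "\<dots> \<le> (1 + norm x) ^ n * (C * (1 + norm x) ^ m) * exp (- a * (norm x)\<^sup>2)"
        using C a by (intro mult_mono power_mono) (auto simp: gauss_def)
      also have "\<dots> = C * ((1 + norm x) ^ (n + m) * exp (- a * (norm x)\<^sup>2))"
        by (simp add: power_add mult_ac)
      also have "\<dots> \<le> C * K" using C K by (intro mult_left_mono) auto
      finally show ?thesis .
    qed
    then show "bounded (range (\<lambda>x. norm x ^ n *\<^sub>R iterated_partial bs (\<lambda>x. of_real (gauss c x)) x))"
      unfolding eq bounded_iff by blast
  qed
qed

lemma gauss_Lp_norm: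
  fixes c :: "'a::euclidean_space \<Rightarrow> real"
  assumes c: "\<And>b. b \<in> Basis \<Longrightarrow> 0 < c b" and r: "0 < r"
  shows "Lp_norm lborel (ennreal r) (\<lambda>x. of_real (gauss c x))
    = ennreal ((sqrt (pi / r) ^ DIM('a) / (\<Prod>b\<in>Basis. c b)) powr (1 / r))"
proof (rule Lp_norm_eqI[OF r])
  show "(\<integral>\<^sup>+ x. ennreal (cmod (complex_of_real (gauss c x)) powr r) \<partial>lborel)
    = ennreal (sqrt (pi / r) ^ DIM('a) / (\<Prod>b\<in>Basis. c b))"
    using nn_integral_gauss[of c r, OF c r] by (simp add: gauss_def)
qed (use c r in \<open>auto intro!: divide_nonneg_nonneg prod_nonneg simp: less_imp_le\<close>)

section \<open>Concentration of the sheet near the origin\<close>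

text \<open>Evaluating at grid points gives approximations of the sheet that are jointly measurable in
  time and \<open>\<omega>\<close>; the process itself need not be.\<close>

definition grid :: "nat \<Rightarrow> real \<Rightarrow> real" where
  "grid m x = max 0 (min 1 (real_of_int \<lfloor>real (Suc m) * x\<rfloor> / real (Suc m)))"

lemma grid_range: "grid m x \<in> {0..1}"
  by (auto simp: grid_def)

text \<open>Rounding down, and not to the nearest grid point, keeps times from [0, \<delta>] inside
  [0, \<delta>], so the second moment bound on the small cube survives the discretisation.\<close>

lemma grid_le: "0 \<le> x \<Longrightarrow> grid m x \<le> x"
  using of_int_floor_le[of "real (Suc m) * x"] by (auto simp: grid_def min_le_iff_disj field_simps)

lemma grid_tendsto:
  assumes x: "x \<in> {0..1}"
  shows "(\<lambda>m. grid m x) \<longlonglongrightarrow> x"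
proof (rule tendsto_sandwich[of "\<lambda>m. x - 1 / real (Suc m)" _ _ "\<lambda>m. x"])
  have "x - 1 / real (Suc m) \<le> grid m x" for m
  proof -
    have "real (Suc m) * x - 1 \<le> real_of_int \<lfloor>real (Suc m) * x\<rfloor>" by linarith
    then have "(real (Suc m) * x - 1) / real (Suc m) \<le> real_of_int \<lfloor>real (Suc m) * x\<rfloor> / real (Suc m)"
      by (rule divide_right_mono) simp
    then have "x - 1 / real (Suc m) \<le> real_of_int \<lfloor>real (Suc m) * x\<rfloor> / real (Suc m)"
      by (simp add: diff_divide_distrib del: of_nat_Suc)
    moreover have "x - 1 / real (Suc m) \<le> 1" using x by (auto intro: order_trans[of _ x])
    ultimately show ?thesis by (simp add: grid_def le_max_iff_disj)
  qed
  then show "\<forall>\<^sub>F m in sequentially. x - 1 / real (Suc m) \<le> grid m x" by simp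
  show "\<forall>\<^sub>F m in sequentially. grid m x \<le> x" using x grid_le by simp
  show "(\<lambda>m. x - 1 / real (Suc m)) \<longlonglongrightarrow> x"
    using tendsto_diff[OF tendsto_const LIMSEQ_inverse_real_of_nat, of x] by (simp add: inverse_eq_divide)
qed simp

lemma emeasure_cube:
  assumes "0 \<le> a"
  shows "emeasure lborel (cbox 0 (vec a) :: (real^'k) set) = ennreal (a ^ CARD('k::finite))"
proof -
  have "emeasure lborel (cbox 0 (vec a) :: (real^'k) set) = ennreal (measure lborel (cbox 0 (vec a) :: (real^'k) set))"
    by (intro emeasure_eq_ennreal_measure) (simp add: emeasure_lborel_cbox_eq)
  also have "measure lborel (cbox 0 (vec a) :: (real^'k) set) = a ^ CARD('k)"
    using assms by (subst content_cbox_if_cart) (auto simp: interval_eq_empty_cart not_less)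
  finally show ?thesis .
qed

context prob_space
begin

text \<open>The definition prescribes the law of increments over s < t only. Hence t = 0 is treated
  apart, and for t > 0 the increment from time 0 is replaced by X t, both through X 0 = 0 almost
  surely.\<close>

lemma brownian_second_moment:
  assumes X: "standard_brownian_motion X" and t: "t \<in> {0..1}"
  shows "(\<integral>\<^sup>+\<omega>. ennreal ((X t \<omega>)\<^sup>2) \<partial>M) = ennreal t"
proof -
  have X0: "AE \<omega> in M. X 0 \<omega> = 0" using X by (simp add: standard_brownian_motion_def)
  show ?thesis
  proof (cases "t = 0")
    case True
    have "(\<integral>\<^sup>+\<omega>. ennreal ((X t \<omega>)\<^sup>2) \<partial>M) = (\<integral>\<^sup>+\<omega>. 0 \<partial>M)"
      by (rule nn_integral_cong_AE) (use X0 True in auto)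
    then show ?thesis using True by simp
  next
    case False
    with t have t': "0 < sqrt t" by simp
    have D: "distributed M lborel (\<lambda>\<omega>. X t \<omega> - X 0 \<omega>) (normal_density 0 (sqrt t))"
    proof -
      have "\<forall>s\<in>{0..1}. \<forall>t\<in>{0..1}. s < t \<longrightarrow>
          distributed M lborel (\<lambda>\<omega>. X t \<omega> - X s \<omega>) (normal_density 0 (sqrt (t - s)))"
        using X unfolding standard_brownian_motion_def by (elim conjE)
      from this[rule_format, of 0 t] t False show ?thesis by simp
    qed
    have "has_bochner_integral lborel (\<lambda>x. normal_density 0 (sqrt t) x * x\<^sup>2) t"
      using normal_moment_even[OF t', of 0 1] t by simp
    then have "(\<integral>\<^sup>+x. ennreal (normal_density 0 (sqrt t) x * x\<^sup>2) \<partial>lborel) = ennreal t"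
      by (subst nn_integral_eq_integral) (auto simp: has_bochner_integral_iff)
    then have "(\<integral>\<^sup>+x. ennreal (normal_density 0 (sqrt t) x) * ennreal (x\<^sup>2) \<partial>lborel) = ennreal t"
      by (simp add: ennreal_mult)
    then have "(\<integral>\<^sup>+\<omega>. ennreal ((X t \<omega> - X 0 \<omega>)\<^sup>2) \<partial>M) = ennreal t"
      by (subst distributed_nn_integral[OF D, symmetric]) auto
    moreover have "(\<integral>\<^sup>+\<omega>. ennreal ((X t \<omega> - X 0 \<omega>)\<^sup>2) \<partial>M) = (\<integral>\<^sup>+\<omega>. ennreal ((X t \<omega>)\<^sup>2) \<partial>M)"
      by (rule nn_integral_cong_AE) (use X0 in auto)
    ultimately show ?thesis by simp
  qed
qed

text \<open>One factor k comes from Cauchy-Schwarz on the k summands, the other from adding k second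
  moments that are each at most \<open>a\<close>.\<close>

lemma sheet_second_moment:
  fixes B :: "'k::finite \<Rightarrow> real \<Rightarrow> 'a \<Rightarrow> real"
  assumes B: "\<And>i. standard_brownian_motion (B i)" and s: "\<And>i. s i \<in> {0..a}" and a: "a \<le> 1"
  shows "(\<integral>\<^sup>+\<omega>. ennreal ((\<Sum>i\<in>UNIV. B i (s i) \<omega>)\<^sup>2) \<partial>M) \<le> ennreal (real CARD('k) ^ 2 * a)"
proof -
  have s1: "s i \<in> {0..1}" for i using s[of i] a by auto
  have a0: "0 \<le> a" using s by fastforce
  have [measurable]: "B i (s i) \<in> borel_measurable M" for i
    using B[of i] s1[of i] by (simp add: standard_brownian_motion_def)
  have "(\<integral>\<^sup>+\<omega>. ennreal ((\<Sum>i\<in>UNIV. B i (s i) \<omega>)\<^sup>2) \<partial>M)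
      \<le> (\<integral>\<^sup>+\<omega>. ennreal (real CARD('k)) * (\<Sum>i\<in>UNIV. ennreal ((B i (s i) \<omega>)\<^sup>2)) \<partial>M)"
  proof (rule nn_integral_mono)
    fix \<omega>
    show "ennreal ((\<Sum>i\<in>UNIV. B i (s i) \<omega>)\<^sup>2) \<le> ennreal (real CARD('k)) * (\<Sum>i\<in>UNIV. ennreal ((B i (s i) \<omega>)\<^sup>2))"
      using sum_squared_le_sum_of_squares[of "\<lambda>i. B i (s i) \<omega>" UNIV]
      by (simp add: sum_ennreal ennreal_mult[symmetric] sum_nonneg ennreal_leI mult.commute)
  qed
  also have "\<dots> = ennreal (real CARD('k)) * (\<Sum>i\<in>UNIV. ennreal (s i))"
    using B s1 by (simp add: nn_integral_cmult nn_integral_sum brownian_second_moment del: sum_ennreal)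
  also have "\<dots> \<le> ennreal (real CARD('k)) * (\<Sum>i\<in>(UNIV :: 'k set). ennreal a)"
    using s by (intro mult_left_mono sum_mono ennreal_leI) auto
  also have "\<dots> = ennreal (real CARD('k) ^ 2 * a)"
    using a0 by (simp add: ennreal_mult power2_eq_square mult.assoc ennreal_of_nat_eq_real_of_nat)
  finally show ?thesis .
qed

text \<open>Chebyshev's inequality is applied in the time variable, path by path, to the mean of W^2
  over the small cube; probability enters through the expectation of that mean.\<close>

lemma sheet_concentration:
  fixes B :: "'k::finite \<Rightarrow> real \<Rightarrow> 'a \<Rightarrow> real"
  assumes B: "\<And>i. standard_brownian_motion (B i)"
  shows "AE \<omega> in M. continuous_on (cbox 0 1) (additive_sheet B \<omega>) \<and>
    (\<exists>\<^sub>F n in sequentially. ennreal (((1/2) ^ n) ^ CARD('k) / 2) \<le>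
      emeasure lborel {t \<in> cbox 0 (vec ((1/2) ^ n)). \<bar>additive_sheet B \<omega> t\<bar> \<le> real (Suc n) * sqrt ((1/2) ^ n)})"
proof -
  interpret P: pair_sigma_finite M lborel ..
  define k where "k = CARD('k)"
  define \<delta> where "\<delta> n = (1/2 :: real) ^ n" for n
  define h where "h n = real (Suc n) * sqrt (\<delta> n)" for n
  define Q where "Q n = (cbox 0 (vec (\<delta> n)) :: (real^'k) set)" for n
  have \<delta>: "0 < \<delta> n" "\<delta> n \<le> 1" for n by (auto simp: \<delta>_def power_le_one)
  have h: "0 < h n" for n using \<delta> by (simp add: h_def)
  have [measurable]: "Q n \<in> sets borel" for n by (simp add: Q_def)
  define V where "V m \<omega> t = (\<Sum>i\<in>UNIV. B i (grid m (t $ i)) \<omega>)" for m \<omega> and t :: "real^'k"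
  have Bm [measurable]: "B i (grid m x) \<in> borel_measurable M" for i m x
    using B[of i] grid_range[of m x] by (simp add: standard_brownian_motion_def)
  have Vm [measurable]: "(\<lambda>(\<omega>, t). V m \<omega> t) \<in> borel_measurable (M \<Otimes>\<^sub>M lborel)" for m
  proof -
    have "(\<lambda>(\<omega>, t). B i (grid m (t $ i)) \<omega>) \<in> borel_measurable (M \<Otimes>\<^sub>M lborel)" for i
    proof -
      \<comment> \<open>The grid point depends on t only through an integer. For each fixed integer
        \<open>z\<close> the map is a random variable, and countably many such pieces are glued
        together.\<close>
      let ?f = "\<lambda>z x. B i (max 0 (min 1 (real_of_int z / real (Suc m)))) (fst x)"
      let ?g = "\<lambda>x :: 'a \<times> (real^'k). \<lfloor>real (Suc m) * (snd x $ i)\<rfloor>"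
      have [measurable]: "B i (max 0 (min 1 (real_of_int z / real (Suc m)))) \<in> borel_measurable M" for z
        using B[of i] by (simp add: standard_brownian_motion_def)
      have "(\<lambda>t :: real^'k. t $ i) \<in> borel_measurable borel"
        by (intro borel_measurable_continuous_onI continuous_intros)
      then have [measurable]: "(\<lambda>t :: real^'k. t $ i) \<in> borel_measurable lborel" by simp
      have "(\<lambda>x. ?f (?g x) x) \<in> borel_measurable (M \<Otimes>\<^sub>M lborel)"
        by (rule measurable_compose_countable) measurable
      then show ?thesis by (simp add: grid_def split_beta')
    qed
    then show ?thesis unfolding V_def split_beta' by (intro borel_measurable_sum) simp
  qed
  \<comment> \<open>On a continuous path this is W^2 throughout the unit cube; being a liminf of
    jointly measurable functions, it is itself jointly measurable, as exchanging the two integrals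
    requires.\<close>
  define L where "L \<omega> t = liminf (\<lambda>m. ennreal ((V m \<omega> t)\<^sup>2))" for \<omega> t
  have Lm [measurable]: "(\<lambda>(\<omega>, t). L \<omega> t) \<in> borel_measurable (M \<Otimes>\<^sub>M lborel)"
    unfolding L_def by measurable
  \<comment> \<open>The Chebyshev ratio: where \<open>L\<close> is W^2, it bounds the fraction of
    \<open>Q n\<close> on which |W| exceeds \<open>h n\<close>.\<close>
  define J where "J n \<omega> = (\<integral>\<^sup>+t. L \<omega> t * indicator (Q n) t \<partial>lborel) / ennreal ((h n)\<^sup>2 * \<delta> n ^ k)" for n \<omega>
  have Jm [measurable]: "J n \<in> borel_measurable M" for n
    unfolding J_def by measurable
  have EJ: "(\<integral>\<^sup>+\<omega>. J n \<omega> \<partial>M) \<le> ennreal (real k ^ 2 / (real (Suc n))\<^sup>2)" for n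
  proof -
    have "(\<integral>\<^sup>+\<omega>. (\<integral>\<^sup>+t. L \<omega> t * indicator (Q n) t \<partial>lborel) \<partial>M) = (\<integral>\<^sup>+t. (\<integral>\<^sup>+\<omega>. L \<omega> t * indicator (Q n) t \<partial>M) \<partial>lborel)"
      by (rule P.Fubini'[symmetric]) measurable
    also have "\<dots> \<le> (\<integral>\<^sup>+t. ennreal (real k ^ 2 * \<delta> n) * indicator (Q n) t \<partial>lborel)"
    proof (rule nn_integral_mono)
      fix t :: "real^'k"
      show "(\<integral>\<^sup>+\<omega>. L \<omega> t * indicator (Q n) t \<partial>M) \<le> ennreal (real k ^ 2 * \<delta> n) * indicator (Q n) t"
      proof (cases "t \<in> Q n")
        case True
        then have t: "t $ i \<in> {0..\<delta> n}" for i by (simp add: Q_def mem_box_cart)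
        have g: "grid m (t $ i) \<in> {0..\<delta> n}" for m i
          using grid_range[of m "t $ i"] grid_le[of "t $ i" m] t[of i] by auto
        have [measurable]: "(\<lambda>\<omega>. V m \<omega> t) \<in> borel_measurable M" for m
          unfolding V_def by measurable
        have "(\<integral>\<^sup>+\<omega>. L \<omega> t \<partial>M) \<le> liminf (\<lambda>m. \<integral>\<^sup>+\<omega>. ennreal ((V m \<omega> t)\<^sup>2) \<partial>M)"
          unfolding L_def by (rule nn_integral_liminf) measurable
        also have "\<dots> \<le> limsup (\<lambda>m. \<integral>\<^sup>+\<omega>. ennreal ((V m \<omega> t)\<^sup>2) \<partial>M)"
          by (rule Liminf_le_Limsup) simp
        also have "\<dots> \<le> ennreal (real k ^ 2 * \<delta> n)"
          unfolding V_def k_def using g \<delta>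
          by (intro Limsup_bounded always_eventually allI sheet_second_moment B) auto
        finally show ?thesis using True by simp
      qed simp
    qed
    also have "\<dots> = ennreal (real k ^ 2 * \<delta> n * \<delta> n ^ k)"
      using \<delta>[of n] by (simp add: nn_integral_cmult_indicator Q_def emeasure_cube k_def ennreal_mult[symmetric] less_imp_le)
    finally have "(\<integral>\<^sup>+\<omega>. J n \<omega> \<partial>M) \<le> ennreal (real k ^ 2 * \<delta> n * \<delta> n ^ k) / ennreal ((h n)\<^sup>2 * \<delta> n ^ k)"
      unfolding J_def by (subst nn_integral_divide) (auto intro!: divide_right_mono_ennreal)
    also have "\<dots> = ennreal (real k ^ 2 / (real (Suc n))\<^sup>2)"
      using \<delta>[of n] h[of n]
      by (subst divide_ennreal) (auto simp: h_def power_mult_distrib less_imp_le simp del: of_nat_Suc)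
    finally show ?thesis .
  qed
  \<comment> \<open>Fatou's lemma over the scales n; the earlier use was over the mesh m of the
    grid. The limit is 0 because of the factor n + 1 in \<open>h n\<close>.\<close>
  have "(\<integral>\<^sup>+\<omega>. liminf (\<lambda>n. J n \<omega>) \<partial>M) \<le> liminf (\<lambda>n. \<integral>\<^sup>+\<omega>. J n \<omega> \<partial>M)"
    by (rule nn_integral_liminf) measurable
  also have "\<dots> \<le> liminf (\<lambda>n. ennreal (real k ^ 2 / (real (Suc n))\<^sup>2))"
    by (intro Liminf_mono always_eventually allI EJ)
  also have "\<dots> = ennreal 0"
  proof (rule lim_imp_Liminf)
    have "(\<lambda>n. real k ^ 2 * (inverse (real (Suc n)))\<^sup>2) \<longlonglongrightarrow> real k ^ 2 * 0\<^sup>2"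
      by (intro tendsto_intros LIMSEQ_inverse_real_of_nat)
    then show "(\<lambda>n. ennreal (real k ^ 2 / (real (Suc n))\<^sup>2)) \<longlonglongrightarrow> ennreal 0"
      by (intro tendsto_ennrealI) (simp add: field_simps)
  qed simp
  finally have "(\<integral>\<^sup>+\<omega>. liminf (\<lambda>n. J n \<omega>) \<partial>M) = 0" by simp
  then have "AE \<omega> in M. liminf (\<lambda>n. J n \<omega>) = 0"
    by (subst (asm) nn_integral_0_iff_AE) auto
  moreover have "AE \<omega> in M. \<forall>i\<in>UNIV. continuous_on {0..1} (\<lambda>t. B i t \<omega>)"
    using B by (subst AE_finite_all) (auto simp: standard_brownian_motion_def)
  ultimately show ?thesis
  proof eventually_elim
    case (elim \<omega>)
    define W where "W = additive_sheet B \<omega>"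
    have cont: "continuous_on (cbox 0 1) W"
      unfolding W_def additive_sheet_def
    proof (intro continuous_on_sum)
      fix i :: 'k
      have sub: "(\<lambda>t :: real^'k. t $ i) ` cbox 0 1 \<subseteq> {0..1}" by (auto simp: mem_box_cart)
      have c1: "continuous_on {0..1} (\<lambda>x. B i x \<omega>)" using elim(2) by simp
      have c2: "continuous_on (cbox 0 1) (\<lambda>t :: real^'k. t $ i)"
        by (intro continuous_on_component continuous_on_id)
      show "continuous_on (cbox 0 1) (\<lambda>t :: real^'k. B i (t $ i) \<omega>)"
        by (rule continuous_on_compose2[OF c1 c2 sub])
    qed
    have Q1: "Q n \<subseteq> cbox 0 1" for n
    proof
      fix t assume t: "t \<in> Q n"
      show "t \<in> cbox 0 1" unfolding mem_box_cart
      proof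
        fix i
        from t have "0 \<le> t $ i \<and> t $ i \<le> \<delta> n" by (simp add: Q_def mem_box_cart)
        then show "0 $ i \<le> t $ i \<and> t $ i \<le> 1 $ i" using \<delta>(2)[of n] by simp
      qed
    qed
    have LW: "L \<omega> t = ennreal ((W t)\<^sup>2)" if "t \<in> cbox 0 1" for t
    proof -
      have t: "t $ i \<in> {0..1}" for i using that by (simp add: mem_box_cart)
      have "(\<lambda>m. B i (grid m (t $ i)) \<omega>) \<longlonglongrightarrow> B i (t $ i) \<omega>" for i
        using elim(2) t[of i] grid_range grid_tendsto[OF t[of i]]
        by (intro continuous_on_tendsto_compose[of "{0..1}" "\<lambda>t. B i t \<omega>"]) auto
      then have "(\<lambda>m. V m \<omega> t) \<longlonglongrightarrow> W t"
        unfolding V_def W_def additive_sheet_def by (intro tendsto_sum)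
      then show ?thesis
        unfolding L_def by (intro lim_imp_Liminf tendsto_intros) auto
    qed
    \<comment> \<open>If J n stayed at or above 1/2 from some n on, its liminf could not be 0. The
      threshold 1/2 is what leaves at least half of the cube to the good set \<open>G\<close>
      below.\<close>
    have freq: "\<exists>\<^sub>F n in sequentially. J n \<omega> < ennreal (1 / 2)"
    proof (rule ccontr)
      assume "\<not> ?thesis"
      then have "\<forall>\<^sub>F n in sequentially. ennreal (1 / 2) \<le> J n \<omega>"
        by (simp add: not_frequently not_less)
      then have "ennreal (1 / 2) \<le> liminf (\<lambda>n. J n \<omega>)" by (rule Liminf_bounded)
      with elim(1) show False by simp
    qed
    have "\<exists>\<^sub>F n in sequentially. ennreal (\<delta> n ^ k / 2) \<le> emeasure lborel {t \<in> Q n. \<bar>W t\<bar> \<le> h n}"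
      using freq
    proof (rule frequently_elim1)
      fix n assume Jn: "J n \<omega> < ennreal (1 / 2)"
      define G where "G = {t \<in> Q n. \<bar>W t\<bar> \<le> h n}"
      have "closed G" unfolding G_def
        by (intro continuous_on_closed_Collect_le continuous_on_rabs continuous_on_subset[OF cont Q1] continuous_on_const)
          (simp add: Q_def closed_cbox)
      then have [measurable]: "G \<in> sets borel" by simp
      have hd: "0 < (h n)\<^sup>2" "0 < \<delta> n ^ k" using \<delta>[of n] h[of n] by auto
      have "ennreal ((h n)\<^sup>2) * emeasure lborel (Q n - G) = (\<integral>\<^sup>+t. ennreal ((h n)\<^sup>2) * indicator (Q n - G) t \<partial>lborel)"
        by (simp add: nn_integral_cmult_indicator)
      also have "\<dots> \<le> (\<integral>\<^sup>+t. L \<omega> t * indicator (Q n) t \<partial>lborel)"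
      proof (rule nn_integral_mono)
        fix t
        show "ennreal ((h n)\<^sup>2) * indicator (Q n - G) t \<le> L \<omega> t * indicator (Q n) t"
        proof (cases "t \<in> Q n - G")
          case True
          then have "h n \<le> \<bar>W t\<bar>" by (auto simp: G_def)
          then have "(h n)\<^sup>2 \<le> (W t)\<^sup>2"
            using h[of n] by (metis abs_le_square_iff abs_of_pos)
          then show ?thesis using True Q1[of n] LW[of t] by (auto intro: ennreal_leI)
        qed simp
      qed
      also have "\<dots> = J n \<omega> * ennreal ((h n)\<^sup>2 * \<delta> n ^ k)"
        unfolding J_def using h[of n] \<delta>(1)[of n] by (subst ennreal_divide_times) (simp add: divide_ennreal)
      also have "\<dots> \<le> ennreal (1 / 2) * ennreal ((h n)\<^sup>2 * \<delta> n ^ k)"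
        using Jn by (intro mult_right_mono) auto
      also have "\<dots> = ennreal ((h n)\<^sup>2) * ennreal (\<delta> n ^ k / 2)"
        using hd by (subst (1 2) ennreal_mult[symmetric]) (auto simp: mult_ac)
      finally have bad: "emeasure lborel (Q n - G) \<le> ennreal (\<delta> n ^ k / 2)"
        using hd by (subst (asm) ennreal_mult_le_mult_iff) auto
      have "ennreal (\<delta> n ^ k) = emeasure lborel (Q n)"
        using \<delta>[of n] by (simp add: Q_def emeasure_cube k_def)
      also have "\<dots> = emeasure lborel G + emeasure lborel (Q n - G)"
      proof -
        have "Q n = G \<union> (Q n - G)" by (auto simp: G_def)
        then show ?thesis by (subst plus_emeasure) auto
      qed
      also have "\<dots> \<le> emeasure lborel G + ennreal (\<delta> n ^ k / 2)"
        using bad by (intro add_left_mono)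
      also have "\<dots> = ennreal (\<delta> n ^ k / 2) + emeasure lborel G"
        by (rule add.commute)
      also have "ennreal (\<delta> n ^ k) = ennreal (\<delta> n ^ k / 2) + ennreal (\<delta> n ^ k / 2)"
        using hd by (subst ennreal_plus[symmetric]) auto
      finally show "ennreal (\<delta> n ^ k / 2) \<le> emeasure lborel {t \<in> Q n. \<bar>W t\<bar> \<le> h n}"
        unfolding G_def[symmetric] by (subst (asm) ennreal_add_left_cancel_le) auto
    qed
    then show ?case using cont unfolding W_def Q_def h_def \<delta>_def k_def by simp
  qed
qed

end

section \<open>The estimates on slabs\<close>

text \<open>Here \<open>u\<close> stands for 1 / s with 1 / \<infinity> = 0, so the endpoint p' =
  \<infinity> of the restriction estimate shares all later computations.\<close>

lemma Lp_norm_ge_cases: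
  assumes "E \<in> sets N" "emeasure N E = ennreal m" "0 < m"
    and "0 \<le> v" "\<And>x. x \<in> E \<Longrightarrow> v \<le> norm (F x)"
    and s: "s = \<infinity> \<and> u = 0 \<or> (\<exists>s'>0. s = ennreal s' \<and> u = 1 / s')"
  shows "ennreal (v * m powr u) \<le> Lp_norm N s F"
  using s
proof
  assume "s = \<infinity> \<and> u = 0"
  then show ?thesis using Lp_norm_infinity_ge[of E N v F] assms by simp
next
  assume "\<exists>s'>0. s = ennreal s' \<and> u = 1 / s'"
  then show ?thesis using Lp_norm_ge[OF assms(1-5)] by auto
qed

definition slab :: "real \<Rightarrow> real \<Rightarrow> ((real ^ 'k) \<times> real) set" where
  "slab \<delta> h = cbox 0 (vec \<delta>) \<times> {-h..h}"

text \<open>The test \<open>snd b = 0\<close> singles out the basis vectors of the factor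
  \<open>real ^ 'k\<close>. The values are half-widths of a centred box around the slab, whose cube
  sits in a corner at the origin.\<close>

definition slab_width :: "real \<Rightarrow> real \<Rightarrow> (real ^ 'k) \<times> real \<Rightarrow> real" where
  "slab_width \<delta> h b = (if snd b = 0 then \<delta> else h)"

lemma slab_measurable [measurable]: "slab \<delta> h \<in> sets borel"
  unfolding slab_def by (intro borel_closed closed_Times closed_cbox closed_atLeastAtMost)

lemma slab_subset: "slab \<delta> h \<subseteq> coord_box (slab_width \<delta> h)"
  by (auto simp: slab_def coord_box_def slab_width_def Basis_prod_def Basis_vec_def
      mem_box_cart inner_axis)

lemma prod_slab_width:
  "(\<Prod>b\<in>Basis. slab_width \<delta> h (b :: (real ^ 'k) \<times> real)) = \<delta> ^ CARD('k::finite) * h"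
proof -
  have "(\<Prod>b\<in>Basis. slab_width \<delta> h (b :: (real ^ 'k) \<times> real)) =
      (\<Prod>b\<in>(\<lambda>u. (u, 0)) ` Basis. slab_width \<delta> h (b :: (real ^ 'k) \<times> real)) *
      (\<Prod>b\<in>(\<lambda>u. (0, u)) ` Basis. slab_width \<delta> h (b :: (real ^ 'k) \<times> real))"
    unfolding Basis_prod_def by (rule prod.union_disjoint) auto
  also have "\<dots> = \<delta> ^ CARD('k) * h"
    by (subst (1 2) prod.reindex) (auto simp: inj_on_def slab_width_def)
  finally show ?thesis .
qed

lemma slab_width_pos: "0 < \<delta> \<Longrightarrow> 0 < h \<Longrightarrow> 0 < slab_width \<delta> h b"
  by (simp add: slab_width_def)

lemma emeasure_surface_measure:
  assumes w: "continuous_on (cbox 0 1) w" and A: "A \<in> sets borel"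
  shows "emeasure (surface_measure w) A = emeasure lborel {t \<in> cbox 0 1. (t, w t) \<in> A}"
proof -
  have "continuous_on (cbox 0 1) (\<lambda>t. (t, w t))"
    using w by (intro continuous_on_Pair continuous_on_id)
  then have "(\<lambda>t. (t, w t)) \<in> borel_measurable (restrict_space borel (cbox 0 1))"
    by (rule borel_measurable_continuous_on_restrict)
  then have meas: "(\<lambda>t. (t, w t)) \<in> restrict_space lborel (cbox 0 1) \<rightarrow>\<^sub>M borel"
    by (subst measurable_cong_sets[OF sets_restrict_space_cong[OF sets_lborel] refl])
  have "emeasure (surface_measure w) A = emeasure (restrict_space lborel (cbox 0 1))
      ((\<lambda>t. (t, w t)) -` A \<inter> space (restrict_space lborel (cbox 0 1)))"
    unfolding surface_measure_def by (rule emeasure_distr[OF meas A])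
  also have "\<dots> = emeasure lborel ((\<lambda>t. (t, w t)) -` A \<inter> space (restrict_space lborel (cbox 0 1)))"
    by (rule emeasure_restrict_space) (auto simp: space_restrict_space)
  also have "(\<lambda>t. (t, w t)) -` A \<inter> space (restrict_space lborel (cbox 0 1)) = {t \<in> cbox 0 1. (t, w t) \<in> A}"
    by (auto simp: space_restrict_space)
  finally show ?thesis .
qed

lemma surface_measure_slab:
  fixes w :: "real ^ 'k::finite \<Rightarrow> real"
  assumes w: "continuous_on (cbox 0 1) w" and \<delta>: "0 \<le> \<delta>" "\<delta> \<le> 1"
    and ge: "ennreal (\<delta> ^ CARD('k) / 2) \<le> emeasure lborel {t \<in> cbox 0 (vec \<delta>). \<bar>w t\<bar> \<le> h}"
  shows "\<exists>m. emeasure (surface_measure w) (slab \<delta> h) = ennreal m \<and> \<delta> ^ CARD('k) / 2 \<le> m"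
proof -
  let ?G = "{t \<in> cbox 0 (vec \<delta>). \<bar>w t\<bar> \<le> h}"
  have "t \<in> cbox 0 1" if "t \<in> cbox 0 (vec \<delta>)" for t :: "real ^ 'k"
    using that \<delta> unfolding mem_box_cart by (auto intro: order_trans)
  then have "{t \<in> cbox 0 1. (t, w t) \<in> slab \<delta> h} = ?G"
    by (auto simp: slab_def)
  then have eq: "emeasure (surface_measure w) (slab \<delta> h) = emeasure lborel ?G"
    by (simp add: emeasure_surface_measure[OF w])
  have "emeasure lborel ?G \<le> emeasure lborel (cbox 0 (vec \<delta>) :: (real ^ 'k) set)"
    by (rule emeasure_mono) auto
  then have "emeasure lborel ?G < \<infinity>"
    using \<delta> by (auto simp: emeasure_cube intro: le_less_trans)
  then obtain m where m: "emeasure lborel ?G = ennreal m" "0 \<le> m"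
    by (cases "emeasure lborel ?G") auto
  with ge have "\<delta> ^ CARD('k) / 2 \<le> m" by (simp add: ennreal_le_iff)
  with eq m show ?thesis by auto
qed

text \<open>Testing on the indicator of the slab compares m times a power of the dual volume with m
  powr (1 / p). Dividing leaves m powr (1 - 1 / p), whose exponent is nonnegative, so
  \<open>m\<close> may be replaced by its lower bound.\<close>

lemma extension_estimate_slab:
  fixes \<mu> :: "((real ^ 'k::finite) \<times> real) measure"
  assumes \<mu>: "sets \<mu> = sets borel" and est: "extension_estimate \<mu> (ennreal p) (ennreal q)"
    and p: "1 \<le> p" and q: "0 < q"
  shows "\<exists>C. \<forall>\<delta> h m. 0 < \<delta> \<longrightarrow> 0 < h \<longrightarrow> emeasure \<mu> (slab \<delta> h) = ennreal m \<longrightarrow> \<delta> ^ CARD('k) / 2 \<le> m \<longrightarrow>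
    (\<delta> ^ CARD('k)) powr (1 - 1 / p) * (1 / (\<delta> ^ CARD('k) * h)) powr (1 / q) \<le> C"
proof -
  obtain c0 where c0: "\<And>f. f \<in> Lp_space \<mu> (ennreal p) \<Longrightarrow>
      Lp_norm lborel (ennreal q) (fourier \<mu> f) \<le> ennreal c0 * Lp_norm \<mu> (ennreal p) f"
    using est by (auto simp: extension_estimate_def)
  \<comment> \<open>The constant in the estimate may be any real number, and \<open>ennreal\<close>
    sends negative ones to 0, so the truncation changes nothing.\<close>
  define c where "c = max 0 c0"
  have c: "0 \<le> c" "ennreal c0 = ennreal c" by (auto simp: c_def ennreal_neg max_def)
  define D where "D = DIM((real ^ 'k) \<times> real)"
  define K where "K = (1 / (pi * D)) ^ D"
  have K: "0 < K" unfolding K_def D_def by (intro zero_less_power divide_pos_pos mult_pos_pos) auto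
  define u where "u = 1 - 1 / p"
  have u: "0 \<le> u" "1 / p = 1 - u" using p by (auto simp: u_def)
  show ?thesis
  \<comment> \<open>The factor 2 powr u pays for the half in the lower bound on \<open>m\<close>,
    the inner 2 for the half of the mass kept by the transform, and \<open>K\<close> for the dual
    box.\<close>
  proof (intro exI[of _ "2 powr u * (2 * c / K powr (1 / q))"] allI impI)
    fix \<delta> h m :: real
    assume \<delta>: "0 < \<delta>" and h: "0 < h" and m: "emeasure \<mu> (slab \<delta> h) = ennreal m" "\<delta> ^ CARD('k) / 2 \<le> m"
    define P where "P = \<delta> ^ CARD('k) * h"
    have P: "0 < P" using \<delta> h by (simp add: P_def)
    have "0 < \<delta> ^ CARD('k) / 2" using \<delta> by simp
    with m have m0: "0 < m" by linarith
    have meas: "slab \<delta> h \<in> sets \<mu>" using \<mu> by simp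
    have norm: "Lp_norm \<mu> (ennreal p) (indicator (slab \<delta> h)) = ennreal (m powr (1 / p))"
    proof (rule Lp_norm_eqI)
      have "(\<integral>\<^sup>+ x. ennreal (cmod (indicator (slab \<delta> h) x) powr p) \<partial>\<mu>) = (\<integral>\<^sup>+ x. indicator (slab \<delta> h) x \<partial>\<mu>)"
        using p by (intro nn_integral_cong) (auto simp: indicator_def)
      then show "(\<integral>\<^sup>+ x. ennreal (cmod (indicator (slab \<delta> h) x) powr p) \<partial>\<mu>) = ennreal m"
        using meas m by simp
    qed (use p m0 in auto)
    have "indicator (slab \<delta> h) \<in> Lp_space \<mu> (ennreal p)"
      using meas norm by (simp add: Lp_space_def)
    from c0[OF this] have "Lp_norm lborel (ennreal q) (fourier \<mu> (indicator (slab \<delta> h))) \<le> ennreal (c * m powr (1 / p))"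
      using c by (simp add: norm ennreal_mult)
    moreover have "ennreal (m / 2 * (K / P) powr (1 / q)) \<le> Lp_norm lborel (ennreal q) (fourier \<mu> (indicator (slab \<delta> h)))"
      using extension_norm_ge[OF \<mu> slab_measurable m(1) _ slab_subset slab_width_pos[OF \<delta> h] q] m0
      by (simp add: K_def D_def P_def prod_slab_width)
    ultimately have "ennreal (m / 2 * (K / P) powr (1 / q)) \<le> ennreal (c * m powr (1 / p))"
      by (rule order_trans[rotated])
    then have le: "m / 2 * (K / P) powr (1 / q) \<le> c * m powr (1 / p)"
      using c by (simp add: ennreal_le_iff)
    have "m powr u * (1 / P) powr (1 / q) = (m * (K / P) powr (1 / q)) * m powr (u - 1) / K powr (1 / q)"
      using m0 K P by (simp add: powr_diff powr_divide)
    also have "\<dots> \<le> (2 * c * m powr (1 / p)) * m powr (u - 1) / K powr (1 / q)"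
      using le by (intro divide_right_mono mult_right_mono) auto
    also have "\<dots> = 2 * c / K powr (1 / q)"
      using m0 by (simp add: u powr_add[symmetric])
    finally have 1: "m powr u * (1 / P) powr (1 / q) \<le> 2 * c / K powr (1 / q)" .
    have "(\<delta> ^ CARD('k)) powr u * (1 / P) powr (1 / q) = 2 powr u * ((\<delta> ^ CARD('k) / 2) powr u * (1 / P) powr (1 / q))"
      using \<delta> by (simp add: powr_divide)
    also have "\<dots> \<le> 2 powr u * (m powr u * (1 / P) powr (1 / q))"
      using m \<delta> u by (intro mult_left_mono mult_right_mono powr_mono2) auto
    also have "\<dots> \<le> 2 powr u * (2 * c / K powr (1 / q))"
      using 1 by (intro mult_left_mono) auto
    finally show "(\<delta> ^ CARD('k)) powr (1 - 1 / p) * (1 / (\<delta> ^ CARD('k) * h)) powr (1 / q)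
        \<le> 2 powr u * (2 * c / K powr (1 / q))"
      by (simp add: u_def P_def)
  qed
qed

text \<open>The transform of a Gaussian adapted to the slab is of order 1 / P on it, with P =
  \<delta>^k h, while the Gaussian has norm of order P powr (- 1 / r). As \<open>r\<close> is
  conjugate to \<open>q\<close>, this leaves the same quantity as for the extension estimate, with
  \<open>u\<close> in the role of 1 - 1 / p.\<close>

lemma restriction_estimate_slab:
  fixes \<mu> :: "((real ^ 'k::finite) \<times> real) measure"
  assumes \<mu>: "sets \<mu> = sets borel" and est: "restriction_estimate \<mu> (ennreal r) s"
    and r: "0 < r" "1 / q + 1 / r = 1"
    and s: "s = \<infinity> \<and> u = 0 \<or> (\<exists>s'>0. s = ennreal s' \<and> u = 1 / s')"
  shows "\<exists>C. \<forall>\<delta> h m. 0 < \<delta> \<longrightarrow> 0 < h \<longrightarrow> emeasure \<mu> (slab \<delta> h) = ennreal m \<longrightarrow> \<delta> ^ CARD('k) / 2 \<le> m \<longrightarrow>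
    (\<delta> ^ CARD('k)) powr u * (1 / (\<delta> ^ CARD('k) * h)) powr (1 / q) \<le> C"
proof -
  obtain c0 where c0: "\<And>f. schwartz f \<Longrightarrow> Lp_norm \<mu> s (fourier lborel f) \<le> ennreal c0 * Lp_norm lborel (ennreal r) f"
    using est by (auto simp: restriction_estimate_def)
  define c where "c = max 0 c0"
  have c: "0 \<le> c" "ennreal c0 = ennreal c" by (auto simp: c_def ennreal_neg max_def)
  define D where "D = DIM((real ^ 'k) \<times> real)"
  obtain \<kappa> where \<kappa>: "0 < \<kappa>" and low: "\<And>a (\<xi> :: (real ^ 'k) \<times> real). (\<And>b. b \<in> Basis \<Longrightarrow> 0 < a b) \<Longrightarrow>
      \<xi> \<in> coord_box (\<lambda>b. \<kappa> * a b) \<Longrightarrow>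
      sqrt pi ^ D / (2 * (\<Prod>b\<in>Basis. a b)) \<le> norm (fourier lborel (\<lambda>x. of_real (gauss a x)) \<xi>)"
    using fourier_gauss_ge[where 'a = "(real ^ 'k) \<times> real"] unfolding D_def by blast
  define K1 where "K1 = sqrt pi ^ D / 2 * \<kappa> ^ D"
  define K2 where "K2 = sqrt (pi / r) ^ D * \<kappa> ^ D"
  have K: "0 < K1" "0 < K2" using \<kappa> r by (auto simp: K1_def K2_def)
  have u: "0 \<le> u" using s by auto
  have rq: "1 / r - 1 = - (1 / q)" using r by linarith
  show ?thesis
  proof (intro exI[of _ "2 powr u * (c * K2 powr (1 / r) / K1)"] allI impI)
    fix \<delta> h m :: real
    assume \<delta>: "0 < \<delta>" and h: "0 < h" and m: "emeasure \<mu> (slab \<delta> h) = ennreal m" "\<delta> ^ CARD('k) / 2 \<le> m"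
    define P where "P = \<delta> ^ CARD('k) * h"
    have P: "0 < P" using \<delta> h by (simp add: P_def)
    have "0 < \<delta> ^ CARD('k) / 2" using \<delta> by simp
    with m have m0: "0 < m" by linarith
    have meas: "slab \<delta> h \<in> sets \<mu>" using \<mu> by simp
    define a where "a b = slab_width \<delta> h b / \<kappa>" for b :: "(real ^ 'k) \<times> real"
    have a: "0 < a b" for b using \<kappa> slab_width_pos[OF \<delta> h, of b] by (simp add: a_def)
    have prod_a: "(\<Prod>b\<in>Basis. a b) = P / \<kappa> ^ D"
      by (simp add: a_def prod_dividef prod_slab_width P_def D_def)
    have "x \<in> coord_box (\<lambda>b. \<kappa> * a b)" if "x \<in> slab \<delta> h" for x
      using that slab_subset[of \<delta> h] \<kappa> by (auto simp: a_def)
    then have v: "K1 / P \<le> norm (fourier lborel (\<lambda>x. of_real (gauss a x)) x)" if "x \<in> slab \<delta> h" for x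
      using low[of a x] that a \<kappa> by (simp add: prod_a K1_def)
    have "ennreal (K1 / P * m powr u) \<le> Lp_norm \<mu> s (fourier lborel (\<lambda>x. of_real (gauss a x)))"
      using K P by (intro Lp_norm_ge_cases[OF meas m(1) m0 _ v s]) auto
    also have "\<dots> \<le> ennreal c * Lp_norm lborel (ennreal r) (\<lambda>x. of_real (gauss a x))"
      using c0[OF schwartz_gauss[of a]] a c by simp
    also have "\<dots> = ennreal (c * (K2 / P) powr (1 / r))"
      using gauss_Lp_norm[of a r] a r c \<kappa> by (simp add: prod_a K2_def D_def ennreal_mult)
    finally have le: "K1 / P * m powr u \<le> c * (K2 / P) powr (1 / r)"
      using c by (simp add: ennreal_le_iff)
    have "m powr u * (1 / P) powr (1 / q) = P powr (1 / r) * (K1 / P * m powr u) / K1"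
    proof -
      have "(1 / P) powr (1 / q) = P powr (1 / r - 1)"
        unfolding rq using P by (simp add: powr_minus_divide powr_divide)
      then show ?thesis using P K by (simp add: powr_diff)
    qed
    also have "\<dots> \<le> P powr (1 / r) * (c * (K2 / P) powr (1 / r)) / K1"
      using le K by (intro divide_right_mono mult_left_mono) auto
    also have "\<dots> = c * K2 powr (1 / r) / K1"
      using P K by (simp add: powr_divide)
    finally have 1: "m powr u * (1 / P) powr (1 / q) \<le> c * K2 powr (1 / r) / K1" .
    have "(\<delta> ^ CARD('k)) powr u * (1 / P) powr (1 / q) = 2 powr u * ((\<delta> ^ CARD('k) / 2) powr u * (1 / P) powr (1 / q))"
      using \<delta> by (simp add: powr_divide)
    also have "\<dots> \<le> 2 powr u * (m powr u * (1 / P) powr (1 / q))"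
      using m \<delta> u by (intro mult_left_mono mult_right_mono powr_mono2) auto
    also have "\<dots> \<le> 2 powr u * (c * K2 powr (1 / r) / K1)"
      using 1 by (intro mult_left_mono) auto
    finally show "(\<delta> ^ CARD('k)) powr u * (1 / (\<delta> ^ CARD('k) * h)) powr (1 / q)
        \<le> 2 powr u * (c * K2 powr (1 / r) / K1)"
      by (simp add: P_def)
  qed
qed

text \<open>With \<delta> = 2^(-n) the expression equals 2^(a n) (n + 1)^(-1/q), and the hypothesis
  on \<open>u\<close> says precisely that the rate a = (k + 1/2) / q - k u is positive.\<close>

lemma scaling_unbounded:
  fixes q u C :: real
  assumes q: "0 < q" and u: "real k * u < (real k + 1 / 2) / q"
  shows "\<forall>\<^sub>F n in sequentially. C < (((1/2) ^ n) ^ k) powr u *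
    (1 / (((1/2) ^ n) ^ k * (real (Suc n) * sqrt ((1/2) ^ n)))) powr (1 / q)"
proof -
  define a where "a = (real k + 1 / 2) / q - real k * u"
  have a: "0 < a" using u by (simp add: a_def)
  define b where "b = 1 / q"
  have eq: "(((1/2) ^ n) ^ k) powr u * (1 / (((1/2) ^ n) ^ k * (real (Suc n) * sqrt ((1/2) ^ n)))) powr (1 / q)
      = 2 powr (a * real n) * (real n + 1) powr (- b)" for n
  proof -
    have p: "(1/2::real) ^ j = 2 powr (- real j)" for j
      by (simp add: powr_minus powr_realpow power_one_over inverse_eq_divide)
    have 1: "((1/2::real) ^ n) ^ k = 2 powr (- (real n * real k))"
      using p[of "n * k"] by (simp add: power_mult)
    have 2: "sqrt ((1/2::real) ^ n) = 2 powr (- (real n / 2))"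
      unfolding p by (subst powr_half_sqrt[symmetric]) (auto simp: powr_powr)
    have "1 / (2 powr (- (real n * real k)) * (real (Suc n) * 2 powr (- (real n / 2))))
        = 2 powr (real n * (real k + 1 / 2)) * (1 / (real n + 1))"
    proof -
      have "2 powr (real n * (real k + 1 / 2)) = 2 powr (real n * real k) * 2 powr (real n / 2)"
        by (simp add: powr_add[symmetric] algebra_simps)
      then show ?thesis by (simp add: powr_minus_divide add.commute)
    qed
    note 3 = this
    have "(2 powr (- (real n * real k))) powr u * (2 powr (real n * (real k + 1 / 2)) * (1 / (real n + 1))) powr (1 / q)
      = 2 powr (- (real n * real k) * u) * 2 powr (real n * (real k + 1 / 2) * b) * (1 / (real n + 1) powr b)"
      by (simp add: powr_mult powr_powr powr_divide b_def)
    also have "2 powr (- (real n * real k) * u) * 2 powr (real n * (real k + 1 / 2) * b) = 2 powr (a * real n)"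
      unfolding powr_add[symmetric] by (simp add: a_def b_def algebra_simps add_divide_distrib)
    finally show ?thesis
      unfolding 1 2 3 by (simp add: powr_minus_divide)
  qed
  have "filterlim (\<lambda>n. 2 powr (a * real n) * (real n + 1) powr (- b)) at_top sequentially"
    using a by real_asymp
  then show ?thesis unfolding eq by (simp add: filterlim_at_top_dense)
qed

theorem corollary2p7:
  fixes M :: "'w measure" and B :: "'k::finite \<Rightarrow> real \<Rightarrow> 'w \<Rightarrow> real" and k :: nat
  assumes "k = CARD('k)"
    and "prob_space M"
    and "prob_space.indep_standard_brownian_motions M B"
  shows "AE \<omega> in M. \<forall>(p::ennreal) (q::real).
           1 \<le> p \<and> 1 \<le> q \<and> 2 * real k * (q - 1) > 1 \<longrightarrow>
             (p < ennreal (2 * real k * q / (2 * real k * (q - 1) - 1)) \<longrightarrow>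
                \<not> extension_estimate (surface_measure (additive_sheet B \<omega>)) p (ennreal q)) \<and>
             (\<forall>p' q'. hoelder_conjugate p p' \<and> hoelder_conjugate (ennreal q) q' \<and>
                p' > ennreal (2 * real k * q / (2 * real k + 1)) \<longrightarrow>
                \<not> restriction_estimate (surface_measure (additive_sheet B \<omega>)) q' p')"
proof -
  interpret prob_space M by fact
  have B: "standard_brownian_motion (B i)" for i
    using assms(3) by (simp add: indep_standard_brownian_motions_def)
  have k: "0 < real k" using assms(1) by simp
  from sheet_concentration[of B, OF B] show ?thesis
  proof eventually_elim
    case (elim \<omega>)
    define w where "w = additive_sheet B \<omega>"
    define \<mu> where "\<mu> = surface_measure w"
    have \<mu>: "sets \<mu> = sets borel" by (simp add: \<mu>_def surface_measure_def)
    define \<delta> where "\<delta> n = (1/2 :: real) ^ n" for n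
    define h where "h n = real (Suc n) * sqrt (\<delta> n)" for n
    have \<delta>: "0 < \<delta> n" "\<delta> n \<le> 1" and h: "0 < h n" for n
      by (auto simp: \<delta>_def h_def power_le_one)
    \<comment> \<open>The contradiction common to both estimates: \<open>u\<close> will be 1 - 1 / p
      for extension and 1 / p' for restriction.\<close>
    have unbounded: False
      if q: "0 < q" and u: "real k * u < (real k + 1 / 2) / q"
        and C: "\<forall>\<delta> h m. 0 < \<delta> \<longrightarrow> 0 < h \<longrightarrow> emeasure \<mu> (slab \<delta> h) = ennreal m \<longrightarrow> \<delta> ^ CARD('k) / 2 \<le> m \<longrightarrow>
          (\<delta> ^ CARD('k)) powr u * (1 / (\<delta> ^ CARD('k) * h)) powr (1 / q) \<le> C"
      for q u C
    proof -
      have "\<exists>\<^sub>F n in sequentially. ennreal (\<delta> n ^ CARD('k) / 2) \<le>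
          emeasure lborel {t \<in> cbox 0 (vec (\<delta> n)). \<bar>w t\<bar> \<le> h n}"
        using elim by (simp add: w_def \<delta>_def h_def)
      \<comment> \<open>Concentration holds for infinitely many n and the growth beyond C for all
        large n, so some n has both.\<close>
      from frequently_eventually_conj[OF this scaling_unbounded[OF q u, of C]]
      obtain n where big: "C < (((1/2) ^ n) ^ k) powr u * (1 / (((1/2) ^ n) ^ k * (real (Suc n) * sqrt ((1/2) ^ n)))) powr (1 / q)"
          and ge: "ennreal (\<delta> n ^ CARD('k) / 2) \<le> emeasure lborel {t \<in> cbox 0 (vec (\<delta> n)). \<bar>w t\<bar> \<le> h n}"
        by (auto dest: frequently_ex)
      obtain m where "emeasure \<mu> (slab (\<delta> n) (h n)) = ennreal m" "\<delta> n ^ CARD('k) / 2 \<le> m"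
        using surface_measure_slab[of w "\<delta> n" "h n"] ge elim \<delta>[of n] by (auto simp: \<mu>_def w_def)
      with C[rule_format, OF \<delta>(1)[of n] h[of n]]
      have "(\<delta> n ^ CARD('k)) powr u * (1 / (\<delta> n ^ CARD('k) * h n)) powr (1 / q) \<le> C" .
      with big show False by (simp add: \<delta>_def h_def assms(1))
    qed
    show ?case unfolding w_def[symmetric] \<mu>_def[symmetric]
    proof (intro allI impI conjI notI; elim conjE)
      fix p :: ennreal and q :: real
      assume p: "1 \<le> p" and q: "1 \<le> q" "2 * real k * (q - 1) > 1"
        and lt: "p < ennreal (2 * real k * q / (2 * real k * (q - 1) - 1))"
        and est: "extension_estimate \<mu> p (ennreal q)"
      \<comment> \<open>In this branch p' is the real value of p, not its conjugate
        exponent.\<close>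
      obtain p' where p': "p = ennreal p'" "0 \<le> p'"
        using lt by (cases p) auto
      have p1: "1 \<le> p'" using p p' by simp
      have "p' < 2 * real k * q / (2 * real k * (q - 1) - 1)"
        using lt p' by (simp add: ennreal_less_iff)
      then have "p' * (2 * real k * (q - 1) - 1) < 2 * real k * q"
        using q by (simp add: pos_less_divide_eq)
      then have u: "real k * (1 - 1 / p') < (real k + 1 / 2) / q"
        using p1 q by (simp add: field_simps)
      from extension_estimate_slab[OF \<mu> est[unfolded p'] p1] q unbounded[OF _ u]
      show False by fastforce
    next
      fix p :: ennreal and q :: real and p' q' :: ennreal
      assume q: "1 \<le> q" "2 * real k * (q - 1) > 1"
        and q': "hoelder_conjugate (ennreal q) q'"
        and gt: "p' > ennreal (2 * real k * q / (2 * real k + 1))"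
        and est: "restriction_estimate \<mu> q' p'"
      have q1: "1 < q" using q by (cases "q = 1") auto
      have hc: "1 / ennreal q + 1 / q' = 1" using q' by (simp add: hoelder_conjugate_def)
      have qq: "1 / ennreal q = ennreal (1 / q)"
        using q1 by (simp add: divide_ennreal flip: ennreal_1)
      \<comment> \<open>The conjugate of q is finite and positive: 0 is excluded since 1 / 0 =
        \<infinity>, and \<infinity> would force q = 1.\<close>
      obtain r where r: "q' = ennreal r" "0 < r" "1 / q + 1 / r = 1"
      proof (cases q')
        case (real r)
        have "r \<noteq> 0" using hc real by auto
        with real have "0 < r" by simp
        moreover have "1 / q' = ennreal (1 / r)"
          using \<open>0 < r\<close> real by (simp add: divide_ennreal flip: ennreal_1)
        with hc qq have "ennreal (1 / q + 1 / r) = ennreal 1"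
          using q1 \<open>0 < r\<close> by simp
        then have "1 / q + 1 / r = 1" using q1 \<open>0 < r\<close> by (subst (asm) ennreal_inj) auto
        ultimately show ?thesis using real that by blast
      next
        case top
        with hc qq have "ennreal (1 / q) = ennreal 1" by simp
        then have "1 / q = 1" using q1 by (subst (asm) ennreal_inj) auto
        with q1 show ?thesis by simp
      qed
      obtain u where s: "p' = \<infinity> \<and> u = 0 \<or> (\<exists>s'>0. p' = ennreal s' \<and> u = 1 / s')"
        and u: "real k * u < (real k + 1 / 2) / q"
      proof (cases p')
        case (real s')
        then have lt: "2 * real k * q / (2 * real k + 1) < s'"
          using gt k q1 by (simp add: ennreal_less_iff)
        moreover have "0 < 2 * real k * q / (2 * real k + 1)" using k q1 by simp
        ultimately have s': "0 < s'" by linarith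
        have "2 * real k * q < s' * (2 * real k + 1)"
          using lt k by (simp add: pos_divide_less_eq)
        then have "real k * (1 / s') < (real k + 1 / 2) / q"
          using s' q1 by (simp add: field_simps)
        with s' real that[of "1 / s'"] show ?thesis by auto
      next
        case top
        with that[of 0] k q1 show ?thesis by simp
      qed
      from restriction_estimate_slab[OF \<mu> est[unfolded r(1)] r(2,3) s] q1 unbounded[OF _ u]
      show False by fastforce
    qed
  qed
qed

end
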